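(* Let $q$ be a prime power, let $V$ be an $n$-dimensional vector space over $\mathbb{F}_q$, let $k \geq 2$ and $n \geq 2k+9$ be integers, and let $\mathcal{F} \subseteq {V \brack k}$ be an intersecting family. Then $$\mathcal{N}(\Delta, \mathcal{F}) \leq n_{3,k},$$ with equality holding if and only if $\mathcal{F}^*_{X,k} \subseteq \mathcal{F} \subseteq \mathcal{F}_{X,k}$ for some $3$-dimensional subspace $X$ of $V$.
   Context: ${V\brack k}$ denotes the set of all $k$-dimensional subspaces of $V$. A family $\mathcal{F}\subseteq{V\brack k}$ is intersecting if $\dim(F_1\cap F_2)\ge 1$ for any $F_1,F_2\in\mathcal{F}$. A triangle in an intersecting family is a set $\{F_1,F_2,F_3\}$ of three (distinct) members with $\dim(F_1\cap F_2\cap F_3)=0$. $\mathcal{N}(\Delta,\mathcal{F})$ is the number of triangles in $\mathcal{F}$, i.e. the number of $3$-element subsets of $\mathcal{F}$ that are pairwise intersecting with $\dim(F_1\cap F_2\cap F_3)=0$. For a subspace $X$ of $V$, $\mathcal{F}_{X,k}=\{F\in{V\brack k}:\dim(F\cap X)\ge\dim(X)-1\}$ and $\mathcal{F}^*_{X,k}=\{F\in{V\brack k}:\dim(F\cap X)=\dim(X)-1\}$. $n_{3,k}=\mathcal{N}(\Delta,\mathcal{F}_{X,k})$, where $X$ is any $3$-dimensional subspace of $V$ (the value does not depend on the choice of $X$). *)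

theory Defs
  imports "HOL-Number_Theory.Number_Theory"
begin

definition (in vector_space) subspaces_of_dim :: "nat \<Rightarrow> 'b set set" where
  "subspaces_of_dim k = {W. subspace W \<and> dim W = k}"

definition (in vector_space) intersecting :: "'b set set \<Rightarrow> bool" where
  "intersecting \<F> \<longleftrightarrow> (\<forall>F1 \<in> \<F>. \<forall>F2 \<in> \<F>. 1 \<le> dim (F1 \<inter> F2))"

definition (in vector_space) triangle :: "'b set set \<Rightarrow> bool" where
  "triangle T \<longleftrightarrow>
     card T = 3 \<and> pairwise (\<lambda>F1 F2. 1 \<le> dim (F1 \<inter> F2)) T \<and> dim (\<Inter>T) = 0"

definition (in vector_space) num_triangles :: "'b set set \<Rightarrow> nat" where
  "num_triangles \<F> = card {T. T \<subseteq> \<F> \<and> triangle T}"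

(* The bound dim (F \<inter> X) \<ge> dim X - 1 is written with + 1 on the other side,
   because subtraction on nat truncates at dim X = 0. *)

definition (in vector_space) subspace_family :: "'b set \<Rightarrow> nat \<Rightarrow> 'b set set" where
  "subspace_family X k = {F \<in> subspaces_of_dim k. dim (F \<inter> X) + 1 \<ge> dim X}"

definition (in vector_space) subspace_family_star :: "'b set \<Rightarrow> nat \<Rightarrow> 'b set set" where
  "subspace_family_star X k = {F \<in> subspaces_of_dim k. dim (F \<inter> X) + 1 = dim X}"

(* An arbitrary 3-dimensional X is chosen; n3_eq_num_triangles shows that the value
   is the same for all of them when V is finite. *)

definition (in vector_space) n3 :: "nat \<Rightarrow> nat" where
  "n3 k = num_triangles (subspace_family (SOME X. X \<in> subspaces_of_dim 3) k)"

context finite_dimensional_vector_space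
begin

lemma ex_linear_automorphism:
  assumes "subspace X" "subspace Y" "dim X = dim Y"
  shows "\<exists>f. Vector_Spaces.linear scale scale f \<and> bij f \<and> f ` X = Y"
proof -
  obtain B where B: "B \<subseteq> X" "independent B" "X \<subseteq> span B" "card B = dim X"
    using basis_exists by blast
  obtain C where C: "C \<subseteq> Y" "independent C" "Y \<subseteq> span C" "card C = dim Y"
    using basis_exists by blast
  have fin: "finite B" "finite C"
    using B C finiteI_independent by auto
  obtain h where h: "bij_betw h B C"
    using fin B(4) C(4) assms(3) finite_same_card_bij[of B C] by auto
  then have hC: "h ` B = C" "inj_on h B"
    by (auto simp: bij_betw_def)
  obtain f where f: "Vector_Spaces.linear scale scale f" "inj f" "\<forall>x\<in>B. f x = h x"
    using linear_independent_extend_inj[of B h] B C hC by auto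
  interpret f: Vector_Spaces.linear scale scale f by fact
  have "span B = X" "span C = Y"
    by (intro antisym span_minimal B C assms)+
  moreover have "f ` B = C"
    using f(3) hC by (auto simp: image_iff)
  ultimately have "f ` X = Y"
    using f.span_image by metis
  moreover have "bij f"
    using f linear_inj_imp_surj by (simp add: bij_def)
  ultimately show ?thesis
    using f by blast
qed

lemma dim_image_bij:
  assumes "Vector_Spaces.linear scale scale f" "bij f"
  shows "dim (f ` S) = dim S"
proof -
  interpret finite_dimensional_vector_space_pair_1 scale Basis scale
    by unfold_locales
  show ?thesis
    by (rule dim_image_eq) (use assms in \<open>auto simp: bij_def intro: inj_on_subset\<close>)
qed

lemma subspace_family_image:
  assumes "Vector_Spaces.linear scale scale f" "bij f"
  shows "(`) f ` subspace_family X k \<subseteq> subspace_family (f ` X) k"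
proof -
  interpret f: Vector_Spaces.linear scale scale f by fact
  have "f ` F \<inter> f ` X = f ` (F \<inter> X)" for F
    using assms by (simp add: bij_def image_Int)
  then show ?thesis
    using assms by (auto simp: subspace_family_def subspaces_of_dim_def
        dim_image_bij f.subspace_image)
qed

lemma triangle_image:
  assumes "Vector_Spaces.linear scale scale f" "bij f" "triangle T"
  shows "triangle ((`) f ` T)"
proof -
  have inj: "inj f" and injI: "inj ((`) f)"
    using assms by (auto simp: bij_def inj_image_eq_iff inj_on_def)
  have "T \<noteq> {}"
    using assms(3) by (auto simp: triangle_def)
  have "card ((`) f ` T) = 3"
    using assms(3) card_image[OF inj_on_subset[OF injI subset_UNIV]]
    by (simp add: triangle_def)
  moreover have "pairwise (\<lambda>F1 F2. 1 \<le> dim (F1 \<inter> F2)) ((`) f ` T)"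
    using assms(3) inj
    by (auto simp: triangle_def pairwise_def image_Int[symmetric] dim_image_bij assms(1,2))
  moreover have "\<Inter> ((`) f ` T) = f ` (\<Inter>T)"
    using image_INT[of f UNIV T "\<lambda>x. x"] inj \<open>T \<noteq> {}\<close> by auto
  ultimately show ?thesis
    using assms by (simp only: triangle_def dim_image_bij simp_thms)
qed

lemma finite_triangles:
  assumes "finite (UNIV :: 'b set)"
  shows "finite {T :: 'b set set. P T}"
proof -
  have "finite (Pow (Pow (UNIV :: 'b set)))"
    using assms by (simp only: finite_Pow_iff)
  then show ?thesis
    by (rule rev_finite_subset) auto
qed

lemma num_triangles_le:
  assumes "finite (UNIV :: 'b set)" "subspace X" "subspace Y" "dim X = dim Y"
  shows "num_triangles (subspace_family X k) \<le> num_triangles (subspace_family Y k)"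
proof -
  obtain f where f: "Vector_Spaces.linear scale scale f" "bij f" "f ` X = Y"
    using ex_linear_automorphism assms by blast
  let ?g = "(`) ((`) f) :: 'b set set \<Rightarrow> 'b set set"
  have "inj ((`) f)"
    using f by (auto simp: bij_def inj_image_eq_iff inj_on_def)
  then have "inj ?g"
    by (intro injI) (simp only: inj_image_eq_iff)
  moreover have "?g ` {T. T \<subseteq> subspace_family X k \<and> triangle T}
      \<subseteq> {T. T \<subseteq> subspace_family Y k \<and> triangle T}"
    using subspace_family_image[OF f(1,2), of X k] triangle_image[OF f(1,2)] f(3) by blast
  ultimately show ?thesis
    unfolding num_triangles_def
    by (intro card_inj_on_le finite_triangles assms(1)) (auto intro: inj_on_subset)
qed

lemma n3_eq_num_triangles:
  assumes "finite (UNIV :: 'b set)" "subspace X" "dim X = 3"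
  shows "n3 k = num_triangles (subspace_family X k)"
proof -
  define Y where "Y = (SOME X. X \<in> subspaces_of_dim 3)"
  have "X \<in> subspaces_of_dim 3"
    using assms(2,3) by (simp add: subspaces_of_dim_def)
  then have "Y \<in> subspaces_of_dim 3"
    unfolding Y_def by (rule someI)
  then have Y: "subspace Y" "dim Y = 3"
    by (simp_all add: subspaces_of_dim_def)
  have "n3 k = num_triangles (subspace_family Y k)"
    by (simp only: n3_def Y_def)
  also have "\<dots> = num_triangles (subspace_family X k)"
    by (rule antisym; rule num_triangles_le) (simp_all only: assms Y)
  finally show ?thesis .
qed

end

end

theory Submission
  imports Defs
begin

text \<open>
  Here a line is a 2-dimensional subspace and a plane a 3-dimensional one. Let $N_i$ be the number
  of $k$-subspaces through a fixed $i$-dimensional subspace. Since $n - k \ge k + 9$, one has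
  $q^k N_{i+1} \le q^{-9} N_i$: if the dimension of a subspace is raised by one in at most $q^k$
  ways, the number of $k$-subspaces through the results still drops by a factor of $q^9$.

  Call a subspace transversal if it meets every member of \<open>\<F>\<close> nontrivially. One may assume that
  \<open>\<F>\<close> is a maximal intersecting family, and that no nonzero vector lies in all members, for
  otherwise there are no triangles. Members are transversal, so each nonzero vector $v$ is missed by
  a transversal. Let $u(v)$ be the least dimension of one missing $v$, take $e$ with $g = u(e)$
  maximal, and let $t \ge 2$ be the least dimension of any transversal.

  Suppose $g \ge 3$. A member through $e$ contains one of the fewer than $q^g$ nonzero vectors of a
  transversal missing $e$, and below dimension $t$ one keeps branching over the vectors of a member,
  so there are at most $q^g q^{k(t-2)} N_t$ of them (\<open>card_star_le\<close>). A member missing $e$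
  contains a nonzero vector $v$ of a $t$-dimensional transversal, then one of a transversal of
  dimension at most $g$ missing $v$, which exists as $u(e)$ is maximal, and one keeps branching
  below dimension $g$. So there are at most $q^{t+g} q^{k(g-2)} N_g$ of them
  (\<open>card_avoiding_le\<close>). With this choice of $e$ the costly factor $q^k$ appears only together
  with a step from $N_i$ to $N_{i+1}$. Each triangle has a member missing $e$, and it follows that
  there are at most about $\frac12 q^2 N_2^3$ triangles.

  If $g = 2$, every nonzero vector is missed by a transversal line. In a maximal family transversal
  lines meet each other, so there are three non-concurrent ones in a plane $X$. A member meeting all
  three meets $X$ in dimension at least 2, so \<open>\<F>\<close> is contained in $\mathcal F_{X,k}$.

  The family of a plane $X$ with basis $x, y, z$ has at least about $q^2 N_2^3$ triangles
  (\<open>num_triangles_subspace_family_ge\<close>): take two members that meet exactly in the span of $z$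
  and contain $x$ and $y$, respectively, and a third one that cuts $X$ in one of the $q^2$ lines
  missing $z$. This beats the bound for $g \ge 3$ by a factor of almost 2. Finally, a
  $k$-subspace containing $X$ lies in no triangle of $\mathcal F_{X,k}$, and each other member of
  $\mathcal F_{X,k}$ lies in one, which gives the case of equality.
\<close>

section \<open>Subspaces of a given dimension through a fixed subspace\<close>

locale vector_space_over_finite_field =
  finite_dimensional_vector_space scale Basis
  for scale :: "'f::{field,finite} \<Rightarrow> 'v::ab_group_add \<Rightarrow> 'v" and Basis :: "'v set" +
  fixes q :: nat
  assumes q_eq_card: "q = card (UNIV :: 'f set)"
begin

lemma q_ge_2: "2 \<le> q"
proof -
  have "card {0, 1 :: 'f} \<le> q" unfolding q_eq_card by (rule card_mono) auto
  then show ?thesis by simp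
qed

lemma card_span_independent:
  assumes "finite B" "independent B"
  shows "card (span B) = q ^ card B \<and> finite (span B)"
  using assms
proof (induction B rule: finite_induct)
  case empty
  then show ?case by simp
next
  case (insert a B)
  then have ind: "independent B" and a: "a \<notin> span B"
    by (auto simp: independent_insert)
  define g where "g = (\<lambda>(c, u). scale c a + u)"
  have "span (insert a B) = g ` (UNIV \<times> span B)"
  proof (rule Set.set_eqI)
    fix x
    have "x \<in> span (insert a B) \<longleftrightarrow> (\<exists>c. x - scale c a \<in> span B)"
      by (rule span_breakdown_eq)
    also have "\<dots> \<longleftrightarrow> x \<in> g ` (UNIV \<times> span B)"
    proof safe
      fix c assume "x - scale c a \<in> span B"
      then show "x \<in> g ` (UNIV \<times> span B)"
        by (intro image_eqI[of _ _ "(c, x - scale c a)"]) (auto simp: g_def)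
    next
      fix c u assume "u \<in> span B"
      then show "\<exists>d. g (c, u) - scale d a \<in> span B"
        by (intro exI[of _ c]) (simp add: g_def)
    qed
    finally show "x \<in> span (insert a B) \<longleftrightarrow> x \<in> g ` (UNIV \<times> span B)" .
  qed
  moreover have "inj_on g (UNIV \<times> span B)"
  proof (rule inj_onI, clarify)
    fix c u d v
    assume uv: "u \<in> span B" "v \<in> span B" and eq: "g (c, u) = g (d, v)"
    have "scale (c - d) a = v - u"
      using eq by (simp add: g_def algebra_simps)
    then have sp: "scale (c - d) a \<in> span B"
      using uv by (simp add: span_diff)
    have "c = d"
    proof (rule ccontr)
      assume "c \<noteq> d"
      then have "a = scale (inverse (c - d)) (scale (c - d) a)" by simp
      then show False using a sp span_scale by metis
    qed
    then show "c = d \<and> u = v" using eq by (simp add: g_def)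
  qed
  ultimately show ?case
    using insert ind by (simp add: card_image card_cartesian_product q_eq_card)
qed

lemma card_subspace: "subspace S \<Longrightarrow> card S = q ^ dim S"
  and finite_UNIV_vector: "finite (UNIV :: 'v set)"
proof -
  assume S: "subspace S"
  obtain B where B: "B \<subseteq> S" "independent B" "S \<subseteq> span B" "card B = dim S"
    using basis_exists by blast
  have "span B = S" by (intro antisym span_minimal B S)
  then show "card S = q ^ dim S"
    using card_span_independent[of B] B finiteI_independent by metis
next
  show "finite (UNIV :: 'v set)"
    using card_span_independent[OF finite_Basis independent_Basis] span_Basis by simp
qed

lemma finite_vectors [simp]: "finite (S :: 'v set)"
  by (rule finite_subset[OF subset_UNIV finite_UNIV_vector])

lemma finite_families [simp]: "finite (\<F> :: 'v set set)"
proof (rule finite_subset)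
  show "\<F> \<subseteq> Pow UNIV" by simp
  show "finite (Pow (UNIV :: 'v set))" by (simp only: finite_Pow_iff finite_UNIV_vector)
qed

lemma ex_superset_of_dim:
  assumes "dim P \<le> i" "i \<le> dimension"
  shows "\<exists>S. P \<subseteq> S \<and> subspace S \<and> dim S = i"
  using assms
proof (induction "i - dim P" arbitrary: P)
  case 0
  then show ?case
    by (intro exI[of _ "span P"]) (simp add: span_superset)
next
  case (Suc j)
  then have "dim P < dimension" by linarith
  then have "span P \<noteq> UNIV"
    using dim_span[of P] by (auto simp: dimension_def simp del: dim_span)
  then obtain v where v: "v \<notin> span P" by auto
  then have "dim (insert v P) = Suc (dim P)" by (simp add: dim_insert)
  with Suc(2-) have "j = i - dim (insert v P)" "dim (insert v P) \<le> i" by auto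
  then have "\<exists>S. insert v P \<subseteq> S \<and> subspace S \<and> dim S = i"
    using Suc(1) Suc(4) by blast
  then show ?case by auto
qed

definition containing :: "nat \<Rightarrow> 'v set \<Rightarrow> 'v set set" where
  "containing k P = {F \<in> subspaces_of_dim k. P \<subseteq> F}"

text \<open>
  The number does not depend on the chosen subspace, because linear automorphisms act transitively
  on the subspaces of a given dimension (\<open>card_containing\<close>). If \<open>i\<close> exceeds the dimension of the
  space there is nothing to choose and the value is meaningless.
\<close>
definition num_containing :: "nat \<Rightarrow> nat \<Rightarrow> nat" where
  "num_containing k i = card (containing k (SOME P. subspace P \<and> dim P = i))"

lemma containing_span: "containing k (span P) = containing k P"
proof -
  have "span P \<subseteq> F \<longleftrightarrow> P \<subseteq> F" if "subspace F" for F
    using span_minimal[OF _ that] span_superset by blast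
  then show ?thesis
    unfolding containing_def subspaces_of_dim_def by auto
qed

lemma card_containing_le:
  assumes "subspace P" "subspace P'" "dim P = dim P'"
  shows "card (containing k P) \<le> card (containing k P')"
proof -
  obtain f where f: "Vector_Spaces.linear scale scale f" "bij f" "f ` P = P'"
    using ex_linear_automorphism assms by blast
  interpret f: Vector_Spaces.linear scale scale f by fact
  have "inj_on ((`) f) (containing k P)"
    using f(2) by (auto simp: bij_def inj_image_eq_iff inj_on_def)
  moreover have "(`) f ` containing k P \<subseteq> containing k P'"
    using f by (auto simp: containing_def subspaces_of_dim_def f.subspace_image dim_image_bij)
  ultimately show ?thesis by (rule card_inj_on_le) simp
qed

lemma card_containing: "card (containing k P) = num_containing k (dim P)"
proof -
  define P' where "P' = (SOME S. subspace S \<and> dim S = dim P)"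
  have "subspace P' \<and> dim P' = dim P"
    unfolding P'_def by (rule someI[of _ "span P"]) simp
  then have "card (containing k (span P)) = card (containing k P')"
    by (intro antisym card_containing_le) auto
  then show ?thesis by (simp add: containing_span num_containing_def P'_def)
qed

lemma num_containing_gt: "k < i \<Longrightarrow> i \<le> dimension \<Longrightarrow> num_containing k i = 0"
proof -
  assume "k < i" "i \<le> dimension"
  then obtain S where S: "subspace S" "dim S = i"
    using ex_superset_of_dim[of "{}" i] by auto
  have False if "F \<in> containing k S" for F
    using that dim_subset[of S F] S \<open>k < i\<close> by (simp add: containing_def subspaces_of_dim_def)
  then have "containing k S = {}" by blast
  then show ?thesis using card_containing[of k S] S by simp
qed

text \<open>
  Both sides count the pairs of a \<open>k\<close>-subspace $F \supseteq S$ and a vector of $F$ outside $S$,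
  for a fixed $S$ of dimension \<open>i\<close>.
\<close>
lemma num_containing_step:
  assumes "i < dimension"
  shows "(q ^ dimension - q ^ i) * num_containing k (Suc i) = (q ^ k - q ^ i) * num_containing k i"
proof -
  obtain S where S: "subspace S" "dim S = i"
    using ex_superset_of_dim[of "{}" i] assms by auto
  let ?C = "containing k S"
  have "(\<Sum>F\<in>?C. card {v \<in> - S. v \<in> F}) = (\<Sum>v\<in>- S. card {F \<in> ?C. v \<in> F})"
    by (rule sum_multicount_gen) auto
  moreover have "card {v \<in> - S. v \<in> F} = q ^ k - q ^ i" if "F \<in> ?C" for F
  proof -
    have F: "subspace F" "dim F = k" "S \<subseteq> F"
      using that by (auto simp: containing_def subspaces_of_dim_def)
    have "{v \<in> - S. v \<in> F} = F - S" by auto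
    then show ?thesis
      using F S by (simp add: card_Diff_subset card_subspace)
  qed
  moreover have "card {F \<in> ?C. v \<in> F} = num_containing k (Suc i)" if "v \<in> - S" for v
  proof -
    have "{F \<in> ?C. v \<in> F} = containing k (insert v S)"
      by (auto simp: containing_def)
    moreover have "dim (insert v S) = Suc i"
      using that S by (simp add: dim_insert span_eq_iff[THEN iffD2])
    ultimately show ?thesis using card_containing by simp
  qed
  moreover have "card (- S) = q ^ dimension - q ^ i"
    using S card_subspace[OF subspace_UNIV]
    by (simp add: Compl_eq_Diff_UNIV card_Diff_subset card_subspace dimension_def)
  ultimately show ?thesis
    using card_containing[of k S] S by (simp add: mult.commute)
qed

lemma num_containing_Suc_le:
  assumes "i < dimension" "k \<le> dimension"
  shows "q ^ (dimension - k) * num_containing k (Suc i) \<le> num_containing k i"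
proof (cases "i < k")
  case False
  then show ?thesis using num_containing_gt[of k "Suc i"] assms by simp
next
  case True
  let ?d = "q ^ dimension - q ^ i"
  have q: "1 < q" using q_ge_2 by simp
  have "?d > 0" using q assms(1) by simp
  have "q ^ (dimension - k) * (q ^ k - q ^ i) \<le> ?d"
  proof -
    have "q ^ (dimension - k) * q ^ k = q ^ dimension"
      using assms by (simp flip: power_add)
    moreover have "1 * q ^ i \<le> q ^ (dimension - k) * q ^ i"
      using q by (intro mult_right_mono) auto
    ultimately show ?thesis by (metis diff_le_mono2 mult_1 right_diff_distrib')
  qed
  then have "(q ^ (dimension - k) * (q ^ k - q ^ i)) * num_containing k i \<le> ?d * num_containing k i"
    by (rule mult_right_mono) simp
  then have "?d * (q ^ (dimension - k) * num_containing k (Suc i)) \<le> ?d * num_containing k i"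
    using num_containing_step[OF assms(1), of k] by (simp add: mult.left_commute mult.assoc)
  then show ?thesis using \<open>?d > 0\<close> by simp
qed

lemma num_containing_add_le:
  assumes "i + j \<le> dimension" "k \<le> dimension"
  shows "q ^ ((dimension - k) * j) * num_containing k (i + j) \<le> num_containing k i"
  using assms(1)
proof (induction j)
  case (Suc j)
  have "q ^ ((dimension - k) * Suc j) * num_containing k (i + Suc j)
      = q ^ ((dimension - k) * j) * (q ^ (dimension - k) * num_containing k (Suc (i + j)))"
    by (simp add: power_add mult_ac)
  also have "\<dots> \<le> q ^ ((dimension - k) * j) * num_containing k (i + j)"
    using Suc assms by (intro mult_left_mono num_containing_Suc_le) auto
  also have "\<dots> \<le> num_containing k i" using Suc by simp
  finally show ?case .
qed simp

lemma num_containing_pos: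
  assumes "i \<le> k" "k \<le> dimension"
  shows "0 < num_containing k i"
proof -
  obtain P where "subspace P" "dim P = i"
    using ex_superset_of_dim[of "{}" i] assms by auto
  moreover obtain S where "subspace S" "dim S = k" "P \<subseteq> S"
    using ex_superset_of_dim[of P k] \<open>dim P = i\<close> assms by auto
  ultimately have "S \<in> containing k P" by (simp add: containing_def subspaces_of_dim_def)
  then have "0 < card (containing k P)" by (simp only: card_gt_0_iff finite_families) blast
  then show ?thesis
    using card_containing[of k P] \<open>dim P = i\<close> by simp
qed

section \<open>Transversals and the branching bounds\<close>

text \<open>
  Raising the dimension costs a factor of at least $q^{n-k} \ge q^{k+9}$, which pays for the $q^k$
  choices of a vector in a branching step and leaves a gain of $q^9$ each time.
\<close>
lemma num_containing_decay:
  assumes "2 * k + 9 \<le> dimension" "2 + j \<le> k"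
  shows "q ^ (9 * j) * (q ^ (k * j) * num_containing k (2 + j)) \<le> num_containing k 2"
proof -
  have "q ^ (9 * j) * q ^ (k * j) = q ^ ((9 + k) * j)"
    by (simp add: power_add distrib_right)
  also have "\<dots> \<le> q ^ ((dimension - k) * j)"
    using assms q_ge_2 by (intro power_increasing mult_right_mono) auto
  finally have "q ^ (9 * j) * q ^ (k * j) * num_containing k (2 + j)
      \<le> q ^ ((dimension - k) * j) * num_containing k (2 + j)"
    by (rule mult_right_mono) simp
  also have "\<dots> \<le> num_containing k 2"
    using assms by (intro num_containing_add_le) auto
  finally show ?thesis by (simp add: mult.assoc)
qed

definition transversal :: "'v set set \<Rightarrow> 'v set \<Rightarrow> bool" where
  "transversal \<F> T \<longleftrightarrow> subspace T \<and> (\<forall>F\<in>\<F>. \<exists>v\<in>F \<inter> T. v \<noteq> 0)"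

lemma one_le_dim_iff: "1 \<le> dim S \<longleftrightarrow> (\<exists>v\<in>S. v \<noteq> 0)"
proof -
  have "1 \<le> dim S \<longleftrightarrow> dim S \<noteq> 0" by linarith
  also have "\<dots> \<longleftrightarrow> (\<exists>v\<in>S. v \<noteq> 0)" unfolding dim_eq_0 by blast
  finally show ?thesis .
qed

lemma intersecting_iff: "intersecting \<F> \<longleftrightarrow> (\<forall>F\<in>\<F>. \<forall>G\<in>\<F>. \<exists>v\<in>F \<inter> G. v \<noteq> 0)"
  unfolding intersecting_def one_le_dim_iff ..

text \<open>
  The elementary branching step: a member that meets \<open>W\<close> contains one of its nonzero vectors.
\<close>
lemma card_branch:
  fixes W P :: "'v set"
  assumes meet: "\<And>G. G \<in> \<G> \<Longrightarrow> \<exists>v\<in>G \<inter> W. v \<noteq> 0"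
    and le: "\<And>v. v \<in> W \<Longrightarrow> v \<noteq> 0 \<Longrightarrow> card {G \<in> \<G>. insert v P \<subseteq> G} \<le> c"
  shows "card {G \<in> \<G>. P \<subseteq> G} \<le> card W * c"
proof -
  have "{G \<in> \<G>. P \<subseteq> G} \<subseteq> (\<Union>v\<in>W - {0}. {G \<in> \<G>. insert v P \<subseteq> G})"
  proof
    fix G assume "G \<in> {G \<in> \<G>. P \<subseteq> G}"
    then have G: "G \<in> \<G>" "P \<subseteq> G" by simp_all
    then obtain v where "v \<in> G \<inter> W" "v \<noteq> 0" using meet by blast
    then show "G \<in> (\<Union>v\<in>W - {0}. {G \<in> \<G>. insert v P \<subseteq> G})"
      using G by (intro UN_I[of v]) auto
  qed
  then have "card {G \<in> \<G>. P \<subseteq> G} \<le> card (\<Union>v\<in>W - {0}. {G \<in> \<G>. insert v P \<subseteq> G})"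
    by (rule card_mono[OF finite_families])
  also have "\<dots> \<le> (\<Sum>v\<in>W - {0}. card {G \<in> \<G>. insert v P \<subseteq> G})"
    by (intro card_UN_le) simp
  also have "\<dots> \<le> card (W - {0}) * c"
  proof -
    have "(\<Sum>v\<in>W - {0}. card {G \<in> \<G>. insert v P \<subseteq> G}) \<le> of_nat (card (W - {0})) * c"
      by (rule sum_bounded_above) (rule le; blast)
    then show ?thesis by (simp only: of_nat_id)
  qed
  also have "\<dots> \<le> card W * c"
    by (intro mult_right_mono card_mono) auto
  finally show ?thesis .
qed

text \<open>
  As long as the span of \<open>P\<close> is too small to be a transversal, some \<open>H\<close> in \<open>\<F>\<close> meets it only in 0,
  and every member through \<open>P\<close> contains a further independent vector from the \<open>q ^ k\<close> vectors of \<open>H\<close>.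
  Only spans inside members of \<open>\<G>\<close> occur, so the hypothesis speaks of these alone. This allows a
  larger \<open>e\<close> when \<open>\<G>\<close> consists of the members missing a given vector.
\<close>
lemma card_extensions_le:
  assumes "\<F> \<subseteq> subspaces_of_dim k" "intersecting \<F>" "\<G> \<subseteq> \<F>"
    and small: "\<And>T G. transversal \<F> T \<Longrightarrow> G \<in> \<G> \<Longrightarrow> T \<subseteq> G \<Longrightarrow> e \<le> dim T"
    and "dim P \<le> e"
  shows "card {G \<in> \<G>. P \<subseteq> G} \<le> q ^ (k * (e - dim P)) * num_containing k e"
  using assms(5)
proof (induction "e - dim P" arbitrary: P)
  case 0
  then have "dim P = e" by simp
  have "card {G \<in> \<G>. P \<subseteq> G} \<le> card (containing k P)"
    using assms(1,3) by (intro card_mono[OF finite_families]) (auto simp: containing_def)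
  then show ?case using \<open>dim P = e\<close> card_containing[of k P] by simp
next
  case (Suc j)
  show ?case
  proof (cases "\<exists>G\<in>\<G>. P \<subseteq> G")
    case False
    then have "{G \<in> \<G>. P \<subseteq> G} = {}" by blast
    then show ?thesis by (simp only: card.empty zero_le)
  next
    case True
    then obtain G where G: "G \<in> \<G>" "P \<subseteq> G" by blast
    then have "subspace G" using assms(1,3) by (auto simp: subspaces_of_dim_def)
    then have "span P \<subseteq> G" using G by (intro span_minimal)
    moreover have "\<not> e \<le> dim (span P)" using Suc.hyps(2) by simp
    ultimately have "\<not> transversal \<F> (span P)" using small G by blast
    then obtain H where H: "H \<in> \<F>" "\<And>v. v \<in> H \<Longrightarrow> v \<in> span P \<Longrightarrow> v = 0"
      by (auto simp: transversal_def)
    have "card {G \<in> \<G>. P \<subseteq> G} \<le> card H * (q ^ (k * j) * num_containing k e)"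
    proof (rule card_branch)
      fix G assume "G \<in> \<G>"
      then show "\<exists>v\<in>G \<inter> H. v \<noteq> 0"
        using assms(2,3) H(1) by (auto simp: intersecting_iff)
    next
      fix v assume "v \<in> H" "v \<noteq> 0"
      then have "v \<notin> span P" using H(2) by blast
      then have d: "dim (insert v P) = Suc (dim P)" by (simp add: dim_insert)
      then have "j = e - dim (insert v P)" "dim (insert v P) \<le> e"
        using Suc.hyps(2) by auto
      then show "card {G \<in> \<G>. insert v P \<subseteq> G} \<le> q ^ (k * j) * num_containing k e"
        using Suc.hyps(1)[of "insert v P"] by simp
    qed
    moreover have "card H = q ^ k"
      using H(1) assms(1) card_subspace by (auto simp: subspaces_of_dim_def)
    moreover have "q ^ k * q ^ (k * j) = q ^ (k * (e - dim P))"
      unfolding Suc.hyps(2)[symmetric] by (simp add: power_add)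
    ultimately show ?thesis by (simp add: mult.assoc[symmetric])
  qed
qed

lemma dim_doubleton:
  assumes "x \<noteq> 0" "v \<noteq> 0" "subspace W" "x \<notin> W" "v \<in> W"
  shows "dim {v, x} = 2"
proof -
  have "span {v} \<subseteq> W" using assms(3,5) by (intro span_minimal) simp
  then have "x \<notin> span {v}" using assms(4) by blast
  then have "dim {x, v} = 2" using assms(2) by (simp add: dim_insert[of x])
  moreover have "{v, x} = {x, v}" by blast
  ultimately show ?thesis by (simp only:)
qed

text \<open>
  The first branching step uses the transversal \<open>W\<close> in place of a member of \<open>\<F>\<close>, which replaces one
  factor \<open>q ^ k\<close> by \<open>q ^ dim W\<close>.
\<close>
lemma card_star_le:
  assumes "\<F> \<subseteq> subspaces_of_dim k" "intersecting \<F>"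
    and "transversal \<F> W" "x \<noteq> 0" "x \<notin> W"
    and small: "\<And>T. transversal \<F> T \<Longrightarrow> t \<le> dim T" and "2 \<le> t"
  shows "card {F \<in> \<F>. x \<in> F} \<le> q ^ dim W * (q ^ (k * (t - 2)) * num_containing k t)"
proof -
  have W: "subspace W" "\<And>F. F \<in> \<F> \<Longrightarrow> \<exists>v\<in>F \<inter> W. v \<noteq> 0"
    using assms(3) unfolding transversal_def by blast+
  have "card {F \<in> \<F>. {x} \<subseteq> F} \<le> card W * (q ^ (k * (t - 2)) * num_containing k t)"
  proof (rule card_branch[OF W(2)])
    fix v assume "v \<in> W" "v \<noteq> 0"
    then have "dim {v, x} = 2" by (intro dim_doubleton[OF \<open>x \<noteq> 0\<close> _ W(1) \<open>x \<notin> W\<close>])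
    then show "card {F \<in> \<F>. {v, x} \<subseteq> F} \<le> q ^ (k * (t - 2)) * num_containing k t"
      using card_extensions_le[OF assms(1,2) order_refl small, of "{v, x}"] \<open>2 \<le> t\<close> by simp
  qed
  then show ?thesis using W(1) by (simp add: card_subspace)
qed

text \<open>
  Here the first two branching steps use transversals: \<open>U\<close>, and then one of dimension at most \<open>g\<close>
  that misses the vector chosen in \<open>U\<close>. The later ones are governed by \<open>g\<close>, as all the subspaces that
  occur lie in members missing \<open>x\<close>.
\<close>
lemma card_avoiding_le:
  assumes "\<F> \<subseteq> subspaces_of_dim k" "intersecting \<F>"
    and "transversal \<F> U"
    and avoid: "\<And>v. v \<noteq> 0 \<Longrightarrow> \<exists>W. transversal \<F> W \<and> v \<notin> W \<and> dim W \<le> g"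
    and small: "\<And>T. transversal \<F> T \<Longrightarrow> x \<notin> T \<Longrightarrow> g \<le> dim T" and "2 \<le> g"
  shows "card {F \<in> \<F>. x \<notin> F} \<le> q ^ dim U * (q ^ g * (q ^ (k * (g - 2)) * num_containing k g))"
proof -
  let ?G = "{F \<in> \<F>. x \<notin> F}" and ?c = "q ^ (k * (g - 2)) * num_containing k g"
  have U: "subspace U" "\<And>F. F \<in> \<F> \<Longrightarrow> \<exists>v\<in>F \<inter> U. v \<noteq> 0"
    using assms(3) unfolding transversal_def by blast+
  have "card {F \<in> ?G. {} \<subseteq> F} \<le> card U * (q ^ g * ?c)"
  proof (rule card_branch)
    show "\<exists>v\<in>F \<inter> U. v \<noteq> 0" if "F \<in> ?G" for F using U(2) that by blast
    fix u assume "u \<in> U" "u \<noteq> 0"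
    obtain W where W: "transversal \<F> W" "u \<notin> W" "dim W \<le> g"
      using avoid \<open>u \<noteq> 0\<close> by blast
    then have W': "subspace W" "\<And>F. F \<in> \<F> \<Longrightarrow> \<exists>v\<in>F \<inter> W. v \<noteq> 0"
      unfolding transversal_def by blast+
    have "card {F \<in> ?G. {u} \<subseteq> F} \<le> card W * ?c"
    proof (rule card_branch)
      show "\<exists>v\<in>F \<inter> W. v \<noteq> 0" if "F \<in> ?G" for F using W'(2) that by blast
      fix v assume "v \<in> W" "v \<noteq> 0"
      then have "dim {v, u} = 2" by (intro dim_doubleton[OF \<open>u \<noteq> 0\<close> _ W'(1) W(2)])
      moreover have "g \<le> dim T" if "transversal \<F> T" "F \<in> ?G" "T \<subseteq> F" for T F
        using small that by blast
      ultimately show "card {F \<in> ?G. {v, u} \<subseteq> F} \<le> ?c"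
        using card_extensions_le[OF assms(1,2), of ?G g "{v, u}"] \<open>2 \<le> g\<close> by simp
    qed
    also have "\<dots> \<le> q ^ g * ?c"
      using W' W q_ge_2 by (intro mult_right_mono) (auto simp: card_subspace intro: power_increasing)
    finally show "card {F \<in> ?G. {u} \<subseteq> F} \<le> q ^ g * ?c" .
  qed
  then show ?thesis using U(1) by (simp add: card_subspace)
qed

text \<open>
  The members of a triangle have no common nonzero vector, so one of them misses \<open>x\<close>.
\<close>
lemma num_triangles_le_avoiding:
  assumes "x \<noteq> 0"
  shows "num_triangles \<F> \<le> card {F \<in> \<F>. x \<notin> F} * (card \<F> choose 2)"
proof -
  let ?G = "{F \<in> \<F>. x \<notin> F}" and ?P = "{P. P \<subseteq> \<F> \<and> card P = 2}"
  have "{T. T \<subseteq> \<F> \<and> triangle T} \<subseteq> (\<lambda>(F, P). insert F P) ` (?G \<times> ?P)"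
  proof safe
    fix T assume T: "T \<subseteq> \<F>" "triangle T"
    then have "x \<notin> \<Inter>T" "card T = 3" using assms by (auto simp: triangle_def)
    then obtain F where F: "F \<in> T" "x \<notin> F" by blast
    have "card (T - {F}) = 2" using F \<open>card T = 3\<close> by simp
    then have "(F, T - {F}) \<in> ?G \<times> ?P" using T F by auto
    moreover have "T = insert F (T - {F})" using F by auto
    ultimately show "T \<in> (\<lambda>(F, P). insert F P) ` (?G \<times> ?P)"
      by (intro image_eqI[of _ _ "(F, T - {F})"]) auto
  qed
  moreover have fin: "finite ?P"
    by (rule finite_subset[of _ "Pow \<F>"]) auto
  ultimately have "num_triangles \<F> \<le> card (?G \<times> ?P)"
    unfolding num_triangles_def by (intro surj_card_le) auto
  also have "\<dots> = card ?G * (card \<F> choose 2)"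
    by (simp add: card_cartesian_product n_subsets)
  finally show ?thesis .
qed

section \<open>Three transversal lines\<close>

lemma dim_3_D:
  assumes "dim {x, y, z} = 3"
  shows "dim {y, z} = 2" "x \<notin> span {y, z}" "y \<notin> span {z}" "z \<noteq> 0"
proof -
  have "dim {y, z} \<le> 2" by (simp add: dim_insert[of y])
  then show x: "x \<notin> span {y, z}" using assms by (auto simp: dim_insert[of x])
  then show 2: "dim {y, z} = 2" using assms by (simp add: dim_insert[of x])
  show "y \<notin> span {z}" using 2 by (auto simp: dim_insert[of y] split: if_splits)
  show "z \<noteq> 0" using 2 by (auto simp: dim_insert[of y] split: if_splits)
qed

lemma span_singleton_sym: "y \<in> span {x} \<Longrightarrow> y \<noteq> 0 \<Longrightarrow> x \<in> span {y}"
  using in_span_insert[of y x "{}"] by simp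

lemma span_doubleton_eq:
  assumes "subspace L" "dim L = 2" "x \<in> L" "y \<in> L" "x \<noteq> 0" "y \<notin> span {x}"
  shows "span {y, x} = L"
proof (rule subspace_dim_equal)
  show "span {y, x} \<subseteq> L" using assms by (intro span_minimal) auto
  show "dim L \<le> dim (span {y, x})" using assms by (simp add: dim_insert[of y])
qed (use assms in auto)

text \<open>
  The lines lie in the plane \<open>X\<close> spanned by \<open>L1\<close> and \<open>L2\<close>. A member meets each of them, and if it met
  \<open>X\<close> in just one point, that point would be common to all three lines, although \<open>e\<close>, the common
  point of \<open>L1\<close> and \<open>L2\<close>, is not on \<open>L3\<close>.
\<close>
lemma subset_subspace_family_of_transversals:
  assumes F: "\<F> \<subseteq> subspaces_of_dim k"
    and L: "transversal \<F> L1" "transversal \<F> L2" "transversal \<F> L3"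
    and dims: "dim L1 = 2" "dim L2 = 2" "dim L3 = 2"
    and meet: "u \<in> L1 \<inter> L3" "u \<noteq> 0" "v \<in> L2 \<inter> L3" "v \<noteq> 0"
    and e: "e \<in> L1 \<inter> L2" "e \<noteq> 0" "e \<notin> L3" and w: "w \<in> L1" "w \<notin> L2"
  shows "\<exists>X\<in>subspaces_of_dim 3. \<F> \<subseteq> subspace_family X k"
proof -
  have sub: "subspace L1" "subspace L2" "subspace L3"
    using L by (simp_all add: transversal_def)
  have e_mem: "e \<in> span {a}" if "a \<in> L1" "a \<in> L2" "a \<noteq> 0" for a
  proof (rule ccontr)
    assume "e \<notin> span {a}"
    then have "span {e, a} = L1" using that e sub dims by (intro span_doubleton_eq) auto
    moreover have "span {e, a} \<subseteq> L2" using that e sub by (intro span_minimal) auto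
    ultimately show False using w by blast
  qed
  have no_common: False if "a \<in> L1" "a \<in> L2" "a \<in> L3" "a \<noteq> 0" for a
  proof -
    have "span {a} \<subseteq> L3" using that sub by (intro span_minimal) auto
    then show False using e_mem that e by blast
  qed
  define X where "X = span (insert w L2)"
  have X: "subspace X" "dim X = 3"
    using w dims by (simp_all add: X_def dim_insert[of w] span_eq_iff[THEN iffD2, OF sub(2)])
  have L2X: "L2 \<subseteq> X" and wX: "w \<in> X" unfolding X_def using span_superset by blast+
  have "w \<notin> span {e}" using w e sub span_minimal[of "{e}" L2] by auto
  then have "span {w, e} = L1" using e w sub dims by (intro span_doubleton_eq) auto
  then have L1X: "L1 \<subseteq> X"
    using span_minimal[of "{w, e}" X] X wX L2X e by auto
  have "u \<notin> L2" using no_common meet by blast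
  then have "u \<notin> span {v}" using span_minimal[of "{v}" L2] sub meet by auto
  then have "span {u, v} = L3" using meet sub dims by (intro span_doubleton_eq) auto
  then have L3X: "L3 \<subseteq> X"
    using span_minimal[of "{u, v}" X] X L1X L2X meet by auto
  have "2 \<le> dim (G \<inter> X)" if G: "G \<in> \<F>" for G
  proof (rule ccontr)
    assume small: "\<not> 2 \<le> dim (G \<inter> X)"
    obtain a1 a2 a3 where a: "a1 \<in> G \<inter> L1" "a1 \<noteq> 0" "a2 \<in> G \<inter> L2" "a2 \<noteq> 0"
        "a3 \<in> G \<inter> L3" "a3 \<noteq> 0"
      using L G unfolding transversal_def by metis
    have par: "a1 \<in> span {b}" if "b \<in> G \<inter> X" "b \<noteq> 0" for b
    proof (rule ccontr)
      assume "a1 \<notin> span {b}"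
      then have "dim {a1, b} = 2" using that by (simp add: dim_insert[of a1])
      then show False using dim_subset[of "{a1, b}" "G \<inter> X"] that a L1X small by auto
    qed
    have "a1 \<in> span {a2}" "a1 \<in> span {a3}" using a L2X L3X by (auto intro!: par)
    then have "a1 \<in> L2" "a1 \<in> L3"
      using span_minimal[of "{a2}" L2] span_minimal[of "{a3}" L3] a sub by auto
    then show False using no_common a by blast
  qed
  then show ?thesis
    using F X by (intro bexI[of _ X]) (auto simp: subspace_family_def subspaces_of_dim_def)
qed

text \<open>
  By maximality every \<open>k\<close>-subspace through \<open>L1\<close> belongs to \<open>\<F>\<close> and therefore meets \<open>L2\<close>. But if the
  lines met only in 0, at most \<open>q ^ 2 * num_containing k 3\<close> of these subspaces would meet \<open>L2\<close>, which
  is not all of them.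
\<close>
lemma transversal_lines_meet:
  assumes n: "2 * k + 9 \<le> dimension" "2 \<le> k"
    and max: "\<And>F. F \<in> subspaces_of_dim k \<Longrightarrow> (\<And>G. G \<in> \<F> \<Longrightarrow> \<exists>v\<in>F \<inter> G. v \<noteq> 0) \<Longrightarrow> F \<in> \<F>"
    and L: "transversal \<F> L1" "transversal \<F> L2" "dim L1 = 2" "dim L2 = 2"
  shows "\<exists>v\<in>L1 \<inter> L2. v \<noteq> 0"
proof (rule ccontr)
  assume disj: "\<not> (\<exists>v\<in>L1 \<inter> L2. v \<noteq> 0)"
  have sub: "subspace L1" "subspace L2"
    using L by (simp_all add: transversal_def)
  define \<G> where "\<G> = {G \<in> containing k L1. \<exists>v\<in>G \<inter> L2. v \<noteq> 0}"
  have "card {G \<in> \<G>. L1 \<subseteq> G} \<le> card L2 * num_containing k 3"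
  proof (rule card_branch)
    show "\<exists>v\<in>G \<inter> L2. v \<noteq> 0" if "G \<in> \<G>" for G using that by (simp add: \<G>_def)
    fix v assume "v \<in> L2" "v \<noteq> 0"
    then have "v \<notin> span L1" using disj by (auto simp: span_eq_iff[THEN iffD2, OF sub(1)])
    then have "dim (insert v L1) = 3" using L by (simp add: dim_insert[of v])
    moreover have "card {G \<in> \<G>. insert v L1 \<subseteq> G} \<le> card (containing k (insert v L1))"
      by (intro card_mono[OF finite_families]) (auto simp: \<G>_def containing_def)
    ultimately show "card {G \<in> \<G>. insert v L1 \<subseteq> G} \<le> num_containing k 3"
      by (simp add: card_containing)
  qed
  moreover have "{G \<in> \<G>. L1 \<subseteq> G} = \<G>" by (auto simp: \<G>_def containing_def)
  ultimately have "card \<G> \<le> q ^ 2 * num_containing k 3"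
    using card_subspace[OF sub(2)] L by simp
  also have "\<dots> < num_containing k 2"
  proof (cases "num_containing k 3 = 0")
    case True
    then show ?thesis using num_containing_pos[of 2 k] n by simp
  next
    case False
    have "q ^ 2 < q ^ (dimension - k)" using q_ge_2 n by (intro power_strict_increasing) auto
    then have "q ^ 2 * num_containing k 3 < q ^ (dimension - k) * num_containing k 3"
      using False by simp
    also have "\<dots> \<le> num_containing k 2"
      using num_containing_Suc_le[of 2 k] n by (simp add: eval_nat_numeral)
    finally show ?thesis .
  qed
  also have "\<dots> = card (containing k L1)" using L by (simp add: card_containing)
  finally have "\<not> containing k L1 \<subseteq> \<G>" using card_mono[OF finite_families] by (metis not_le)
  then obtain F where F: "F \<in> containing k L1" "F \<notin> \<G>" by blast
  have "F \<in> \<F>"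
  proof (rule max)
    show "F \<in> subspaces_of_dim k" using F by (simp add: containing_def)
    fix G assume "G \<in> \<F>"
    then obtain v where "v \<in> G \<inter> L1" "v \<noteq> 0" using L by (auto simp: transversal_def)
    then show "\<exists>v\<in>F \<inter> G. v \<noteq> 0" using F by (auto simp: containing_def)
  qed
  then show False using F L by (auto simp: transversal_def \<G>_def)
qed

section \<open>Triangles in the family of a plane\<close>

text \<open>
  The pairs of sides through the vertex \<open>z\<close> in the triangles that are used for the lower bound.
\<close>
definition pairs_meeting_in :: "nat \<Rightarrow> 'v \<Rightarrow> 'v \<Rightarrow> 'v \<Rightarrow> ('v set \<times> 'v set) set" where
  "pairs_meeting_in k z x y =
    {(F, G). F \<in> containing k {x, z} \<and> G \<in> containing k {y, z} \<and> F \<inter> G \<subseteq> span {z}}"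

lemma finite_pairs [simp]: "finite (R :: ('v set \<times> 'v set) set)"
  by (rule finite_subset[of _ "UNIV \<times> UNIV"]) (simp, intro finite_cartesian_product finite_families)

text \<open>
  A pair is lost if the two subspaces share a vector \<open>v\<close> outside the span of \<open>z\<close>. If \<open>v\<close> lies on one
  of the lines spanned by \<open>x, z\<close> and \<open>y, z\<close>, then one of the subspaces contains the whole plane.
  Otherwise each of them contains a plane through its line and \<open>v\<close>.
\<close>
lemma card_pairs_meeting_in:
  assumes "dim {x, y, z} = 3"
  shows "num_containing k 2 ^ 2 \<le> card (pairs_meeting_in k z x y)
    + 2 * num_containing k 2 * num_containing k 3 + q ^ dimension * num_containing k 3 ^ 2"
proof -
  let ?C = "containing k"
  define V where "V = {v. v \<notin> span {x, z} \<and> v \<notin> span {y, z}}"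
  define R where "R = (\<Union>v\<in>V. ?C {v, x, z} \<times> ?C {v, y, z})"
  have perm: "{y, x, z} = {x, y, z}" by blast
  have d: "dim {x, z} = 2" "dim {y, z} = 2"
    using assms dim_3_D(1)[of y x z] dim_3_D(1)[of x y z] unfolding perm by simp_all
  have outside: "(F, G) \<in> pairs_meeting_in k z x y"
    if FG: "F \<in> ?C {x, z}" "G \<in> ?C {y, z}"
      and n1: "G \<notin> ?C {x, y, z}" and n2: "F \<notin> ?C {x, y, z}" and nR: "(F, G) \<notin> R" for F G
  proof -
    have sp: "span S \<subseteq> F" if "S \<subseteq> F" for S
      using FG that span_minimal by (auto simp: containing_def subspaces_of_dim_def)
    have sp': "span S \<subseteq> G" if "S \<subseteq> G" for S
      using FG that span_minimal by (auto simp: containing_def subspaces_of_dim_def)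
    have xG: "x \<notin> G" using n1 FG by (auto simp: containing_def)
    have yF: "y \<notin> F" using n2 FG by (auto simp: containing_def)
    have "v \<in> span {z}" if v: "v \<in> F" "v \<in> G" for v
    proof (rule ccontr)
      assume nz: "v \<notin> span {z}"
      have "v \<notin> span {x, z}"
      proof
        assume "v \<in> span {x, z}"
        then have "x \<in> span {v, z}" using nz by (rule in_span_insert)
        then show False using sp'[of "{v, z}"] v FG xG by (auto simp: containing_def)
      qed
      moreover have "v \<notin> span {y, z}"
      proof
        assume "v \<in> span {y, z}"
        then have "y \<in> span {v, z}" using nz by (rule in_span_insert)
        then show False using sp[of "{v, z}"] v FG yF by (auto simp: containing_def)
      qed
      ultimately have "(F, G) \<in> R" using FG v unfolding R_def V_def containing_def by blast
      then show False using nR by blast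
    qed
    then show ?thesis
      using FG by (auto simp: pairs_meeting_in_def)
  qed
  have cover: "?C {x, z} \<times> ?C {y, z} \<subseteq>
      pairs_meeting_in k z x y \<union> (?C {x, z} \<times> ?C {x, y, z} \<union> ?C {x, y, z} \<times> ?C {y, z}) \<union> R"
    using outside by blast
  have "card R \<le> (\<Sum>v\<in>V. card (?C {v, x, z} \<times> ?C {v, y, z}))"
    unfolding R_def by (rule card_UN_le) simp
  also have "\<dots> = card V * num_containing k 3 ^ 2"
    using d by (simp add: V_def card_cartesian_product card_containing dim_insert[of _ "{x, z}"]
        dim_insert[of _ "{y, z}"] power2_eq_square)
  also have "\<dots> \<le> q ^ dimension * num_containing k 3 ^ 2"
  proof -
    have "card V \<le> card (UNIV :: 'v set)" by (rule card_mono) auto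
    then show ?thesis using card_subspace[OF subspace_UNIV] by (simp add: dimension_def)
  qed
  finally have R: "card R \<le> q ^ dimension * num_containing k 3 ^ 2" .
  have "num_containing k 2 ^ 2 = card (?C {x, z} \<times> ?C {y, z})"
    using d by (simp add: card_cartesian_product card_containing power2_eq_square)
  also have "\<dots> \<le> card (pairs_meeting_in k z x y \<union>
      (?C {x, z} \<times> ?C {x, y, z} \<union> ?C {x, y, z} \<times> ?C {y, z}) \<union> R)"
    by (rule card_mono[OF finite_pairs cover])
  also have "\<dots> \<le> card (pairs_meeting_in k z x y) +
      (card (?C {x, z} \<times> ?C {x, y, z}) + card (?C {x, y, z} \<times> ?C {y, z})) + card R"
    by (intro order_trans[OF card_Un_le] add_mono order_refl)
  also have "card (?C {x, z} \<times> ?C {x, y, z}) + card (?C {x, y, z} \<times> ?C {y, z})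
      = 2 * num_containing k 2 * num_containing k 3"
    using d assms by (simp add: card_cartesian_product card_containing)
  finally show ?thesis using R by linarith
qed

lemma triangle_iff:
  "triangle {F, G, H} \<longleftrightarrow> F \<noteq> G \<and> F \<noteq> H \<and> G \<noteq> H \<and>
    (\<exists>v\<in>F \<inter> G. v \<noteq> 0) \<and> (\<exists>v\<in>F \<inter> H. v \<noteq> 0) \<and> (\<exists>v\<in>G \<inter> H. v \<noteq> 0) \<and> F \<inter> G \<inter> H \<subseteq> {0}"
proof (cases "F \<noteq> G \<and> F \<noteq> H \<and> G \<noteq> H")
  case False
  then have "card {F, G, H} \<noteq> 3"
    by (auto simp: card_insert_if)
  then have "\<not> triangle {F, G, H}" unfolding triangle_def by (rule contrapos_nn) (rule conjunct1)
  then show ?thesis using False by meson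
next
  case True
  then have "card {F, G, H} = 3" by simp
  moreover have "dim (\<Inter>{F, G, H}) = 0 \<longleftrightarrow> F \<inter> G \<inter> H \<subseteq> {0}"
    by (simp add: Int_assoc)
  moreover have "G \<inter> F = F \<inter> G" "H \<inter> F = F \<inter> H" "H \<inter> G = G \<inter> H" by blast+
  then have "pairwise (\<lambda>F G. 1 \<le> dim (F \<inter> G)) {F, G, H} \<longleftrightarrow>
      1 \<le> dim (F \<inter> G) \<and> 1 \<le> dim (F \<inter> H) \<and> 1 \<le> dim (G \<inter> H)"
    using True unfolding pairwise_def by (metis insertE insertI1 insertI2 singletonD)
  ultimately show ?thesis
    using True unfolding triangle_def one_le_dim_iff by blast
qed

text \<open>
  The sides opposite to the vertex \<open>z\<close>: every line of the plane that misses \<open>z\<close> is spanned by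
  \<open>x + scale a z\<close> and \<open>y + scale b z\<close> for unique coefficients \<open>a\<close> and \<open>b\<close>.
\<close>
definition base_side :: "nat \<Rightarrow> 'v \<Rightarrow> 'v \<Rightarrow> 'v \<Rightarrow> 'v set set" where
  "base_side k z x y = {F \<in> subspaces_of_dim k. z \<notin> F \<and>
    (\<exists>a b. x + scale a z \<in> F \<and> y + scale b z \<in> F)}"

lemma dim_shear:
  assumes "dim {x, y, z} = 3"
  shows "dim {x + scale a z, y + scale b z, z} = 3"
proof -
  let ?S = "span {x + scale a z, y + scale b z, z}"
  have m: "x + scale a z \<in> ?S" "y + scale b z \<in> ?S" "z \<in> ?S" by (auto intro: span_base)
  have "x \<in> ?S" using span_diff[OF m(1) span_scale[OF m(3), of a]] by simp
  moreover have "y \<in> ?S" using span_diff[OF m(2) span_scale[OF m(3), of b]] by simp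
  ultimately have "{x, y, z} \<subseteq> ?S" using m by blast
  then have "3 \<le> dim {x + scale a z, y + scale b z, z}"
    using dim_mono[of "{x, y, z}"] assms by metis
  moreover have "dim {x + scale a z, y + scale b z, z} \<le> 3"
    by (simp add: dim_insert[of _ "{_, _}"] dim_insert[of _ "{_}"])
  ultimately show ?thesis by simp
qed

text \<open>
  There are \<open>q ^ 2\<close> lines of the plane missing \<open>z\<close>, and of the \<open>k\<close>-subspaces through one of them
  exactly those containing the whole plane contain \<open>z\<close>.
\<close>
lemma card_base_side:
  assumes "dim {x, y, z} = 3"
  shows "q ^ 2 * (num_containing k 2 - num_containing k 3) \<le> card (base_side k z x y)"
proof -
  define D where "D = (\<lambda>(a, b). containing k {x + scale a z, y + scale b z} - containing k {x, y, z})"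
  have mem: "x + scale a z \<in> F \<longleftrightarrow> x \<in> F" if "subspace F" "z \<in> F" for x a F
    using that subspace_diff[OF that(1), of "x + scale a z" "scale a z"]
      subspace_add[OF that(1)] subspace_scale[OF that] by auto
  have card_D: "card (D p) = num_containing k 2 - num_containing k 3" for p
  proof -
    obtain a b where p: "p = (a, b)" by fastforce
    have sub: "containing k {x, y, z} \<subseteq> containing k {x + scale a z, y + scale b z}"
      by (auto simp: containing_def subspaces_of_dim_def mem)
    have "{z, x + scale a z, y + scale b z} = {x + scale a z, y + scale b z, z}" by blast
    then have "dim {x + scale a z, y + scale b z} = 2"
      using dim_3_D(1)[of z "x + scale a z" "y + scale b z"] dim_shear[OF assms, of a b] by simp
    then show ?thesis
      using sub assms by (simp add: p D_def card_Diff_subset card_containing)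
  qed
  have z_mem: "z \<in> F" if "subspace F" "x + scale a z \<in> F" "x + scale a' z \<in> F" "a \<noteq> a'" for F x a a'
  proof -
    have "scale (a - a') z \<in> F"
      using subspace_diff[OF that(1-3)] by (simp add: algebra_simps)
    then have "scale (inverse (a - a')) (scale (a - a') z) \<in> F"
      by (rule subspace_scale[OF that(1)])
    then show ?thesis using that(4) by simp
  qed
  have no_z: "z \<notin> F" if "F \<in> D (a, b)" for F a b
    using that mem by (auto simp: D_def containing_def subspaces_of_dim_def)
  have disj: "D p \<inter> D p' = {}" if "p \<noteq> p'" for p p'
  proof -
    obtain a b a' b' where p: "p = (a, b)" "p' = (a', b')" by fastforce
    have False if F: "F \<in> D (a, b)" "F \<in> D (a', b')" for F
    proof -
      have "subspace F" "x + scale a z \<in> F" "x + scale a' z \<in> F" "y + scale b z \<in> F" "y + scale b' z \<in> F"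
        using F by (auto simp: D_def containing_def subspaces_of_dim_def)
      then show False using z_mem no_z[OF F(1)] \<open>p \<noteq> p'\<close> p by (metis (no_types))
    qed
    then show ?thesis using p by blast
  qed
  have "(\<Sum>p\<in>(UNIV :: ('f \<times> 'f) set). card (D p)) = card (\<Union>p\<in>UNIV. D p)"
    by (rule card_UN_disjoint[symmetric]) (auto simp: disj)
  also have "\<dots> \<le> card (base_side k z x y)"
  proof (rule card_mono[OF finite_families], rule subsetI)
    fix F assume "F \<in> (\<Union>p\<in>UNIV. D p)"
    then obtain a b where F: "F \<in> D (a, b)" by auto
    then show "F \<in> base_side k z x y"
      using no_z[OF F] by (auto simp: D_def base_side_def containing_def)
  qed
  also have "(\<Sum>p\<in>(UNIV :: ('f \<times> 'f) set). card (D p)) = q ^ 2 * (num_containing k 2 - num_containing k 3)"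
    by (simp add: card_D q_eq_card power2_eq_square card_cartesian_product flip: UNIV_Times_UNIV)
  finally show ?thesis .
qed

text \<open>
  The last five statements tell the three sides apart, so that the triangle as a set determines
  which of its members plays which part.
\<close>
lemma base_side_triangle:
  assumes "dim {x, y, z} = 3" "F \<in> base_side k z x y" "(G, H) \<in> pairs_meeting_in k z x y"
  shows "triangle {F, G, H}" "{F, G, H} \<subseteq> subspace_family (span {x, y, z}) k"
    and "x \<in> G" "x \<notin> H" "z \<in> G" "z \<in> H" "z \<notin> F"
proof -
  let ?X = "span {x, y, z}"
  obtain a b where F: "subspace F" "dim F = k" "z \<notin> F" "x + scale a z \<in> F" "y + scale b z \<in> F"
    using assms(2) by (auto simp: base_side_def subspaces_of_dim_def)
  have GH: "subspace G" "dim G = k" "x \<in> G" "z \<in> G" "subspace H" "dim H = k" "y \<in> H" "z \<in> H"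
      "G \<inter> H \<subseteq> span {z}"
    using assms(3) by (auto simp: pairs_meeting_in_def containing_def subspaces_of_dim_def)
  have perm: "{y, x, z} = {x, y, z}" "{z, x + scale a z, y + scale b z} = {x + scale a z, y + scale b z, z}"
      "{x + scale a z, z, y + scale b z} = {x + scale a z, y + scale b z, z}" by blast+
  have d: "dim {x, z} = 2" "dim {y, z} = 2" "x \<notin> span {z}" "z \<noteq> 0"
    using assms(1) dim_3_D(1,3)[of y x z] dim_3_D(1,4)[of x y z] unfolding perm by simp_all
  have xH: "x \<notin> H" using GH(3,9) d(3) by blast
  show "x \<in> G" "x \<notin> H" "z \<in> G" "z \<in> H" "z \<notin> F" using GH F xH by simp_all
  have s: "dim {x + scale a z, y + scale b z} = 2" "x + scale a z \<noteq> 0" "y + scale b z \<noteq> 0"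
  proof -
    note d3 = dim_shear[OF assms(1), of a b]
    show "dim {x + scale a z, y + scale b z} = 2"
      using dim_3_D(1)[of z] d3 unfolding perm(2)[symmetric] by blast
    then show "x + scale a z \<noteq> 0" "y + scale b z \<noteq> 0"
      using dim_insert[of "x + scale a z" "{y + scale b z}"] span_zero[of "{y + scale b z}"]
      by (auto split: if_splits)
  qed
  have mG: "x + scale a z \<in> G" by (intro subspace_add subspace_scale GH)
  have mH: "y + scale b z \<in> H" by (intro subspace_add subspace_scale GH)
  have FGH: "v = 0" if "v \<in> F" "v \<in> G" "v \<in> H" for v
  proof (rule ccontr)
    assume "v \<noteq> 0"
    moreover have "v \<in> span {z}" using that GH by blast
    ultimately have "z \<in> span {v}" using span_singleton_sym by blast
    moreover have "span {v} \<subseteq> F" using that F by (intro span_minimal) auto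
    ultimately show False using F by blast
  qed
  show "triangle {F, G, H}"
    unfolding triangle_iff
  proof (intro conjI)
    show "F \<noteq> G" "F \<noteq> H" "G \<noteq> H" using F(3) GH(3,4,8) xH by blast+
    show "\<exists>v\<in>F \<inter> G. v \<noteq> 0" using F(4) mG s(2) by blast
    show "\<exists>v\<in>F \<inter> H. v \<noteq> 0" using F(5) mH s(3) by blast
    show "\<exists>v\<in>G \<inter> H. v \<noteq> 0" using GH(4,8) d(4) by blast
    show "F \<inter> G \<inter> H \<subseteq> {0}" using FGH by blast
  qed
  have mem: "x \<in> ?X" "y \<in> ?X" "z \<in> ?X" by (auto intro: span_base)
  have memX: "x + scale a z \<in> ?X" "y + scale b z \<in> ?X" by (intro span_add span_scale mem)+
  have "2 \<le> dim (F \<inter> ?X)" "2 \<le> dim (G \<inter> ?X)" "2 \<le> dim (H \<inter> ?X)"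
    using dim_subset[of "{x + scale a z, y + scale b z}" "F \<inter> ?X"] dim_subset[of "{x, z}" "G \<inter> ?X"]
      dim_subset[of "{y, z}" "H \<inter> ?X"] F GH s d mem memX by simp_all
  then show "{F, G, H} \<subseteq> subspace_family ?X k"
    using F(1,2) GH(1,2,5,6) assms(1) by (simp add: subspace_family_def subspaces_of_dim_def)
qed

lemma num_triangles_subspace_family_ge:
  assumes "dim {x, y, z} = 3"
  shows "q ^ 2 * (num_containing k 2 - num_containing k 3) * card (pairs_meeting_in k z x y)
    \<le> num_triangles (subspace_family (span {x, y, z}) k)"
proof -
  let ?B = "base_side k z x y" and ?P = "pairs_meeting_in k z x y"
  let ?f = "\<lambda>(F, G, H). {F, G, H}"
  have inj: "inj_on ?f (?B \<times> ?P)"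
  proof (rule inj_onI)
    fix p p' assume pp: "p \<in> ?B \<times> ?P" "p' \<in> ?B \<times> ?P" "?f p = ?f p'"
    obtain F G H F' G' H' where p: "p = (F, G, H)" "p' = (F', G', H')"
      using prod_cases3 by metis
    then have m: "F \<in> ?B" "(G, H) \<in> ?P" "F' \<in> ?B" "(G', H') \<in> ?P" using pp(1,2) by simp_all
    have eq: "{F, G, H} = {F', G', H'}" using pp(3) p by simp
    note t = base_side_triangle(3-7)[OF assms m(1,2)] and t' = base_side_triangle(3-7)[OF assms m(3,4)]
    have "F \<in> {F', G', H'}" "G \<in> {F', G', H'}" "H \<in> {F', G', H'}" unfolding eq[symmetric] by blast+
    then show "p = p'" using t t' p by blast
  qed
  have "card (?B \<times> ?P) = card (?f ` (?B \<times> ?P))" by (rule card_image[OF inj, symmetric])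
  also have "\<dots> \<le> num_triangles (subspace_family (span {x, y, z}) k)"
    unfolding num_triangles_def
  proof (rule card_mono[OF finite_triangles[OF finite_vectors]], rule image_subsetI)
    fix p assume "p \<in> ?B \<times> ?P"
    obtain F G H where p0: "p = (F, G, H)" by (rule prod_cases3)
    with \<open>p \<in> ?B \<times> ?P\<close> have p: "F \<in> ?B" "(G, H) \<in> ?P" by simp_all
    show "?f p \<in> {T. T \<subseteq> subspace_family (span {x, y, z}) k \<and> triangle T}"
      using base_side_triangle(1,2)[OF assms p] p0 by simp
  qed
  finally show ?thesis
    using card_base_side[OF assms, of k] by (auto simp: card_cartesian_product intro: order_trans mult_right_mono)
qed

lemma ex_basis_of_plane:
  assumes "subspace X" "dim X = 3"
  shows "\<exists>x y z. dim {x, y, z} = 3 \<and> span {x, y, z} = X"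
proof -
  obtain B where B: "B \<subseteq> X" "independent B" "X \<subseteq> span B" "card B = dim X"
    using basis_exists by blast
  then obtain x y z where "B = {x, y, z}" using assms by (auto simp: card_3_iff)
  moreover have "span B = X" using B assms by (intro antisym span_minimal)
  ultimately show ?thesis using assms by (intro exI[of _ x] exI[of _ y] exI[of _ z]) (metis dim_span)
qed

lemma num_triangles_mono: "\<F> \<subseteq> \<G> \<Longrightarrow> num_triangles \<F> \<le> num_triangles \<G>"
  unfolding num_triangles_def by (rule card_mono[OF finite_triangles[OF finite_vectors]]) blast

lemma subspaces_of_plane_meet:
  assumes "subspace X" "dim X = 3" "subspace P" "P \<subseteq> X" "2 \<le> dim P"
    and "subspace Q" "Q \<subseteq> X" "2 \<le> dim Q"
  shows "\<exists>v\<in>P \<inter> Q. v \<noteq> 0"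
proof (cases "Q \<subseteq> P")
  case True
  then show ?thesis using assms one_le_dim_iff[of Q] by auto
next
  case False
  then obtain c where c: "c \<in> Q" "c \<notin> P" by blast
  have "\<not> Q \<subseteq> span {c}"
    using dim_mono[of Q "{c}"] assms by (auto split: if_splits)
  then obtain d where d: "d \<in> Q" "d \<notin> span {c}" by blast
  have "span (insert c P) = X"
  proof (rule subspace_dim_equal)
    show "span (insert c P) \<subseteq> X" using assms c by (intro span_minimal) auto
    show "dim X \<le> dim (span (insert c P))"
      using assms c by (simp add: dim_insert[of c] span_eq_iff[THEN iffD2, OF assms(3)])
  qed (use assms in auto)
  then have "d \<in> span (insert c P)" using d assms by blast
  then obtain t where "d - scale t c \<in> P"
    unfolding span_breakdown_eq span_eq_iff[THEN iffD2, OF assms(3)] by blast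
  moreover have "d - scale t c \<in> Q"
    using assms c d by (intro subspace_diff subspace_scale)
  moreover have "d - scale t c \<noteq> 0"
    using d span_scale[OF span_base[of c "{c}"], of t] by auto
  ultimately show ?thesis by blast
qed

text \<open>
  A member containing \<open>X\<close> cannot be in a triangle, because two others each meet \<open>X\<close> in dimension at
  least 2 and so meet each other inside \<open>X\<close>.
\<close>
lemma triangle_subset_star:
  assumes "subspace X" "dim X = 3" "T \<subseteq> subspace_family X k" "triangle T"
  shows "T \<subseteq> subspace_family_star X k"
proof
  fix A assume A: "A \<in> T"
  have "card T = 3" using assms(4) by (simp add: triangle_def)
  then obtain B C where T: "T = {A, B, C}"
    using A by (auto simp: card_3_iff)
  have BC: "subspace B" "2 \<le> dim (B \<inter> X)" "subspace C" "2 \<le> dim (C \<inter> X)"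
    and A2: "2 \<le> dim (A \<inter> X)" "subspace A" "A \<in> subspaces_of_dim k"
    using assms(2,3) by (auto simp: T subspace_family_def subspaces_of_dim_def)
  have "dim (A \<inter> X) \<noteq> 3"
  proof
    assume "dim (A \<inter> X) = 3"
    then have "A \<inter> X = X"
      using subspace_dim_equal[of "A \<inter> X" X] assms A2 by (simp add: subspace_inter)
    moreover have "\<exists>v\<in>B \<inter> C \<inter> X. v \<noteq> 0"
      using subspaces_of_plane_meet[OF assms(1,2), of "B \<inter> X" "C \<inter> X"] BC assms(1)
      by (auto simp: subspace_inter)
    moreover have "A \<inter> B \<inter> C \<subseteq> {0}" using assms(4) T triangle_iff by metis
    ultimately show False by blast
  qed
  moreover have "dim (A \<inter> X) \<le> 3" using dim_subset[of "A \<inter> X" X] assms by simp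
  ultimately show "A \<in> subspace_family_star X k"
    using A2 assms(2) by (simp add: subspace_family_star_def)
qed

lemma num_triangles_between:
  assumes "subspace X" "dim X = 3" "subspace_family_star X k \<subseteq> \<F>" "\<F> \<subseteq> subspace_family X k"
  shows "num_triangles \<F> = num_triangles (subspace_family X k)"
proof -
  have "T \<subseteq> \<F>" if "T \<subseteq> subspace_family X k" "triangle T" for T
    using triangle_subset_star[OF assms(1,2) that] assms(3) by blast
  then have "{T. T \<subseteq> \<F> \<and> triangle T} = {T. T \<subseteq> subspace_family X k \<and> triangle T}"
    using assms(4) by blast
  then show ?thesis by (simp only: num_triangles_def)
qed

end

section \<open>Comparison of the two bounds\<close>

text \<open>
  Here \<open>A\<close> and \<open>B\<close> stand for the numbers of members missing and containing \<open>e\<close>, \<open>M\<close> for the number of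
  \<open>k\<close>-subspaces through a line, and $t = 2 + i$, $g = 3 + j$ in the notation of the introduction.
  For $i = 0$ the bound on \<open>B\<close> dominates the sum, and $A B^2 \le q^{2 - 6 j} M^3$. For $i > 0$ both
  bounds are so small that the product is at most $M^3$.
\<close>
lemma triangle_bound_arith:
  fixes q A B M i j :: nat
  assumes q: "2 \<le> q" and ij: "i \<le> j + 1"
    and A: "A * q ^ (9 * (j + 1)) \<le> q ^ (5 + i + j) * M"
    and B: "B * q ^ (9 * i) \<le> q ^ (3 + j) * M"
  shows "32 * (A * (A + B) ^ 2) \<le> 33 * q ^ 2 * M ^ 3"
proof -
  have q0: "0 < q" using q by simp
  have mono: "q ^ a \<le> q ^ b" if "a \<le> b" for a b using q that by (intro power_increasing) auto
  \<comment> \<open>the exponents in the hypothesis on \<open>A\<close> have \<open>5 + j\<close> in common\<close>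
  have "q ^ (5 + j) * (A * q ^ (4 + 8 * j)) \<le> q ^ (5 + j) * (q ^ i * M)"
    using A by (simp add: power_add[symmetric] algebra_simps)
  then have A': "A * q ^ (4 + 8 * j) \<le> q ^ i * M" using q0 by simp
  have q3: "8 \<le> q ^ 3" using power_mono[OF q, of 3] by simp
  show ?thesis
  proof (cases i)
    case 0
    have "A * q ^ (4 + 2 * j) \<le> A * q ^ (4 + 8 * j)" by (intro mult_left_mono mono) auto
    then have A2: "A * q ^ (4 + 2 * j) \<le> M" using A' 0 by (simp only: power_0 mult_1)
    have "A * 16 \<le> A * q ^ (4 + 2 * j)"
      using power_mono[OF q, of 4] mono[of 4 "4 + 2 * j"] by (intro mult_left_mono) auto
    then have "128 * A \<le> 8 * M" using A2 by linarith
    also have "\<dots> \<le> q ^ (3 + j) * M" using q3 mono[of 3 "3 + j"] by (intro mult_right_mono) auto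
    finally have "128 * (A + B) \<le> 129 * (q ^ (3 + j) * M)" using B 0 by simp
    then have "(128 * (A + B)) ^ 2 \<le> (129 * (q ^ (3 + j) * M)) ^ 2" by (rule power_mono) simp
    then have "A * (128 * (A + B)) ^ 2 \<le> A * (129 * (q ^ (3 + j) * M)) ^ 2"
      by (rule mult_left_mono) simp
    also have "\<dots> = 16641 * q ^ 2 * M ^ 2 * (A * q ^ (4 + 2 * j))"
    proof -
      have "(q ^ (3 + j)) ^ 2 = q ^ 2 * q ^ (4 + 2 * j)"
        by (simp add: mult.commute flip: power_add power_mult)
      then show ?thesis by (simp add: power_mult_distrib mult_ac)
    qed
    also have "\<dots> \<le> 16641 * q ^ 2 * M ^ 2 * M" using A2 by (rule mult_left_mono) simp
    also have "\<dots> = 16641 * (q ^ 2 * M ^ 3)" by (simp add: power3_eq_cube power2_eq_square)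
    also have "A * (128 * (A + B)) ^ 2 = 16384 * (A * (A + B) ^ 2)"
      unfolding power_mult_distrib[of 128 "A + B" 2] by simp
    finally have "16384 * (A * (A + B) ^ 2) \<le> 16641 * (q ^ 2 * M ^ 3)" .
    then show ?thesis by (simp add: mult.assoc)
  next
    case (Suc i')
    have "q ^ 3 * (B * q ^ 6) \<le> B * q ^ (9 * i)"
      using mono[of 9 "9 * i"] Suc by (simp add: power_add[symmetric] mult.left_commute)
    also have "\<dots> \<le> q ^ 3 * (q ^ j * M)" using B by (simp add: power_add mult.assoc)
    finally have B2: "B * q ^ 6 \<le> q ^ j * M" using q0 by simp
    have "q ^ (j + 1) * q ^ (3 + 7 * j) = q ^ (4 + 8 * j)"
      unfolding power_add[symmetric] by (rule arg_cong[of _ _ "(^) q"]) simp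
    then have "q ^ (j + 1) * (A * q ^ (3 + 7 * j)) \<le> q ^ i * M"
      using A' by (simp only: mult.left_commute[of _ A])
    also have "\<dots> \<le> q ^ (j + 1) * M" by (intro mult_right_mono mono ij) simp
    finally have A2: "A * q ^ (3 + 7 * j) \<le> M" using q0 by simp
    have "A * 8 \<le> A * q ^ (3 + 7 * j)"
      using q3 mono[of 3 "3 + 7 * j"] by (intro mult_left_mono) auto
    then have "A * 8 \<le> M" using A2 by linarith
    also have "\<dots> \<le> q ^ j * M" using q0 by simp
    finally have A3: "A * 8 \<le> q ^ j * M" .
    have "B * 64 \<le> B * q ^ 6" using power_mono[OF q, of 6] by (intro mult_left_mono) auto
    then have "A + B \<le> q ^ j * M" using A3 B2 by linarith
    then have "A * (A + B) ^ 2 \<le> A * (q ^ j * M) ^ 2" by (intro mult_left_mono power_mono) auto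
    also have "\<dots> = (A * q ^ (2 * j)) * M ^ 2"
      by (simp add: power_mult_distrib power_mult[symmetric] mult_ac)
    also have "\<dots> \<le> M * M ^ 2"
    proof -
      have "A * q ^ (2 * j) \<le> A * q ^ (3 + 7 * j)" by (intro mult_left_mono mono) auto
      from order_trans[OF this A2] show ?thesis by (rule mult_right_mono) simp
    qed
    finally have "A * (A + B) ^ 2 \<le> M ^ 3" by (simp add: power3_eq_cube power2_eq_square)
    also have "\<dots> \<le> q ^ 2 * M ^ 3" using q0 by simp
    finally show ?thesis by (simp add: mult.assoc)
  qed
qed

context vector_space_over_finite_field
begin

lemma num_containing_3_le:
  assumes "2 * k + 9 \<le> dimension" "2 \<le> k"
  shows "2048 * num_containing k 3 \<le> num_containing k 2"
proof -
  let ?M = "num_containing k 2" and ?N = "num_containing k 3" and ?m = "dimension - k"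
  have NM: "q ^ ?m * ?N \<le> ?M"
    using num_containing_Suc_le[of 2 k] assms by (simp add: eval_nat_numeral)
  \<comment> \<open>\<open>dimension - k\<close> is at least \<open>k + 9\<close>, hence at least 11\<close>
  have "(2048 :: nat) = 2 ^ 11" by simp
  also have "\<dots> \<le> q ^ 11" using q_ge_2 by (intro power_mono) auto
  also have "\<dots> \<le> q ^ ?m" using assms q_ge_2 by (intro power_increasing) auto
  finally have "2048 * ?N \<le> q ^ ?m * ?N" by (rule mult_right_mono) simp
  then show ?thesis using NM by linarith
qed

lemma card_pairs_meeting_in_ge:
  assumes "2 * k + 9 \<le> dimension" "2 \<le> k" "dim {x, y, z} = 3"
  shows "1021 * num_containing k 2 ^ 2 \<le> 1024 * card (pairs_meeting_in k z x y)"
proof -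
  let ?M = "num_containing k 2" and ?N = "num_containing k 3" and ?m = "dimension - k"
  have NM: "q ^ ?m * ?N \<le> ?M"
    using num_containing_Suc_le[of 2 k] assms by (simp add: eval_nat_numeral)
  \<comment> \<open>two dimension steps outweigh \<open>q ^ dimension\<close>, as \<open>dimension + 9 \<le> 2 * (dimension - k)\<close>\<close>
  have "(512 :: nat) = 2 ^ 9" by simp
  also have "\<dots> \<le> q ^ 9" using q_ge_2 by (intro power_mono) auto
  finally have "512 * q ^ dimension \<le> q ^ 9 * q ^ dimension" by (rule mult_right_mono) simp
  also have "\<dots> \<le> q ^ (2 * ?m)"
    unfolding power_add[symmetric] using assms q_ge_2 by (intro power_increasing) auto
  also have "\<dots> = (q ^ ?m) ^ 2" by (simp add: power_mult[symmetric] mult.commute)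
  finally have "512 * q ^ dimension * ?N ^ 2 \<le> (q ^ ?m) ^ 2 * ?N ^ 2" by (rule mult_right_mono) simp
  also have "\<dots> \<le> ?M ^ 2" unfolding power_mult_distrib[symmetric] using NM by (rule power_mono) simp
  finally have n: "512 * (q ^ dimension * ?N ^ 2) \<le> ?M ^ 2" by (simp add: mult.assoc)
  \<comment> \<open>1021/1024 is what remains of 1 after subtracting 2/2048 and 1/512\<close>
  have "2048 * (?M * ?N) \<le> ?M * ?M" 
    using mult_left_mono[OF num_containing_3_le[OF assms(1,2)], of ?M] by (simp add: mult.left_commute)
  then show ?thesis
    using card_pairs_meeting_in[OF assms(3), of k] n
    unfolding power2_eq_square mult.assoc by linarith
qed

text \<open>
  The number of triangles is at least nearly \<open>q ^ 2 * num_containing k 2 ^ 3\<close>. Any constant above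
  $\frac{33}{64}$ in place of $\frac{31}{32}$ would do for the comparison with
  \<open>num_triangles_le_if_no_avoiding_line\<close>.
\<close>
lemma num_triangles_subspace_family_ge_cube:
  assumes "2 * k + 9 \<le> dimension" "2 \<le> k" "subspace X" "dim X = 3"
  shows "31 * q ^ 2 * num_containing k 2 ^ 3 \<le> 32 * num_triangles (subspace_family X k)"
proof -
  let ?M = "num_containing k 2" and ?N = "num_containing k 3"
  obtain x y z where xyz: "dim {x, y, z} = 3" "span {x, y, z} = X"
    using ex_basis_of_plane assms by blast
  let ?p = "card (pairs_meeting_in k z x y)"
  have p: "1021 * ?M ^ 2 \<le> 1024 * ?p" by (rule card_pairs_meeting_in_ge[OF assms(1,2) xyz(1)])
  have "2047 * ?M \<le> 2048 * (?M - ?N)" using num_containing_3_le[OF assms(1,2)] by linarith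
  then have "(2047 * ?M) * (1021 * ?M ^ 2) \<le> (2048 * (?M - ?N)) * (1024 * ?p)"
    using p by (rule mult_mono) simp_all
  then have "q ^ 2 * ((2047 * ?M) * (1021 * ?M ^ 2)) \<le> q ^ 2 * ((2048 * (?M - ?N)) * (1024 * ?p))"
    by (rule mult_left_mono) simp
  also have "\<dots> = 2097152 * (q ^ 2 * (?M - ?N) * ?p)" by (simp add: mult_ac)
  also have "\<dots> \<le> 2097152 * num_triangles (subspace_family X k)"
    using num_triangles_subspace_family_ge[OF xyz(1), of k] xyz(2) by (intro mult_left_mono) auto
  finally have "2089987 * (q ^ 2 * ?M ^ 3) \<le> 2097152 * num_triangles (subspace_family X k)"
    by (simp add: power3_eq_cube power2_eq_square mult_ac)
  then show ?thesis by (simp add: mult.assoc)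
qed

lemma transversal_dim_ge_2:
  assumes "transversal \<F> T" and nontriv: "\<And>x. x \<noteq> 0 \<Longrightarrow> \<exists>F\<in>\<F>. x \<notin> F"
    and "\<F> \<noteq> {}" "\<F> \<subseteq> subspaces_of_dim k"
  shows "2 \<le> dim T"
proof (rule ccontr)
  assume small: "\<not> 2 \<le> dim T"
  obtain F where "F \<in> \<F>" using assms(3) by blast
  then obtain v where v: "v \<in> T" "v \<noteq> 0" using assms(1) by (auto simp: transversal_def)
  obtain G where G: "G \<in> \<F>" "v \<notin> G" using nontriv v by blast
  obtain w where w: "w \<in> G \<inter> T" "w \<noteq> 0" using G assms(1) by (auto simp: transversal_def)
  have "span {w} \<subseteq> G" using w G assms(4) by (intro span_minimal) (auto simp: subspaces_of_dim_def)
  then have "v \<notin> span {w}" using G by blast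
  then have "dim {v, w} = 2" using w by (simp add: dim_insert[of v])
  then show False using dim_subset[of "{v, w}" T] v w small by auto
qed

text \<open>
  The case $g \ge 3$ of the introduction.
\<close>
lemma num_triangles_le_if_no_avoiding_line:
  assumes n: "2 * k + 9 \<le> dimension" "2 \<le> k"
    and F: "\<F> \<subseteq> subspaces_of_dim k" "intersecting \<F>"
    and nontriv: "\<And>x. x \<noteq> 0 \<Longrightarrow> \<exists>F\<in>\<F>. x \<notin> F"
    and x: "x \<noteq> 0" "\<And>W. transversal \<F> W \<Longrightarrow> x \<notin> W \<Longrightarrow> 3 \<le> dim W"
  shows "64 * num_triangles \<F> \<le> 33 * q ^ 2 * num_containing k 2 ^ 3"
proof -
  let ?M = "num_containing k 2"
  have self: "transversal \<F> G" "dim G = k" if "G \<in> \<F>" for G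
    using F that by (auto simp: transversal_def intersecting_iff subspaces_of_dim_def)
  \<comment> \<open>the least dimension of a transversal missing \<open>v\<close>; it is at most \<open>k\<close> as members are transversals\<close>
  define u where "u v = (LEAST d. \<exists>W. transversal \<F> W \<and> v \<notin> W \<and> dim W = d)" for v
  have u: "\<exists>W. transversal \<F> W \<and> v \<notin> W \<and> dim W = u v" "u v \<le> k" if "v \<noteq> 0" for v
  proof -
    have ex: "\<exists>W. transversal \<F> W \<and> v \<notin> W \<and> dim W = k" using nontriv[OF that] self by blast
    show "\<exists>W. transversal \<F> W \<and> v \<notin> W \<and> dim W = u v" unfolding u_def by (rule LeastI_ex) (use ex in blast)
    show "u v \<le> k" unfolding u_def by (rule Least_le) (rule ex)
  qed
  have u_le: "u v \<le> dim W" if "transversal \<F> W" "v \<notin> W" for v W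
    unfolding u_def by (rule Least_le) (use that in blast)
  \<comment> \<open>this choice lets every nonzero vector be missed by a transversal of dimension at most \<open>g\<close>\<close>
  define g where "g = Max (u ` (- {0}))"
  have ne: "u ` (- {0}) \<noteq> {}" using x(1) by blast
  then have "g \<in> u ` (- {0})" unfolding g_def by (intro Max_in) auto
  then obtain e where e: "e \<noteq> 0" "u e = g" by auto
  have g_max: "u v \<le> g" if "v \<noteq> 0" for v unfolding g_def using that by (intro Max_ge) auto
  obtain W where W: "transversal \<F> W" "e \<notin> W" "dim W = g" using u(1)[OF e(1)] e(2) by blast
  have "3 \<le> u x" using u(1)[OF x(1)] x(2) by metis
  then have g3: "3 \<le> g" using g_max[OF x(1)] by linarith
  have gk: "g \<le> k" using u(2)[OF e(1)] e(2) by simp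
  define t where "t = (LEAST d. \<exists>T. transversal \<F> T \<and> dim T = d)"
  have t_le: "t \<le> dim T" if "transversal \<F> T" for T
    unfolding t_def by (rule Least_le) (use that in blast)
  have "\<exists>T. transversal \<F> T \<and> dim T = t"
    unfolding t_def by (rule LeastI_ex) (use W in blast)
  then obtain U where U: "transversal \<F> U" "dim U = t" by blast
  have "\<F> \<noteq> {}" using nontriv[OF x(1)] by blast
  then have t2: "2 \<le> t" using transversal_dim_ge_2[OF U(1) nontriv] F(1) U(2) by blast
  have tg: "t \<le> g" using t_le[OF W(1)] W(3) by simp
  define A B where "A = card {F \<in> \<F>. e \<notin> F}" and "B = card {F \<in> \<F>. e \<in> F}"
  define i j where "i = t - 2" and "j = g - 3"
  have ij: "t = 2 + i" "g = 2 + (j + 1)" "i \<le> j + 1" using t2 g3 tg by (auto simp: i_def j_def)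
  then have tgij: "t + g = 5 + i + j" "g = 3 + j" by simp_all
  have avoid: "\<exists>W. transversal \<F> W \<and> v \<notin> W \<and> dim W \<le> g" if "v \<noteq> 0" for v
    using u(1)[OF that] g_max[OF that] by metis
  have "A \<le> q ^ t * (q ^ g * (q ^ (k * (g - 2)) * num_containing k g))"
    unfolding A_def U(2)[symmetric]
    by (rule card_avoiding_le[OF F U(1) avoid]) (use u_le e g3 in auto)
  then have "A * q ^ (9 * (j + 1))
      \<le> q ^ (t + g) * (q ^ (9 * (j + 1)) * (q ^ (k * (j + 1)) * num_containing k (2 + (j + 1))))"
    using mult_right_mono[of A _ "q ^ (9 * (j + 1))"] unfolding ij by (simp add: power_add mult_ac)
  also have "\<dots> \<le> q ^ (t + g) * ?M"
    using num_containing_decay[OF n(1), of "j + 1"] gk ij by (intro mult_left_mono) auto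
  finally have A: "A * q ^ (9 * (j + 1)) \<le> q ^ (5 + i + j) * ?M"
    using tgij by (simp only:)
  have "B \<le> q ^ g * (q ^ (k * (t - 2)) * num_containing k t)"
    unfolding B_def W(3)[symmetric]
    by (rule card_star_le[OF F W(1) e(1) W(2) t_le t2])
  then have "B * q ^ (9 * i) \<le> q ^ g * (q ^ (9 * i) * (q ^ (k * i) * num_containing k (2 + i)))"
    using mult_right_mono[of B _ "q ^ (9 * i)"] unfolding ij by (simp add: mult_ac)
  also have "\<dots> \<le> q ^ g * ?M"
    using num_containing_decay[OF n(1), of i] gk tg ij by (intro mult_left_mono) auto
  finally have B: "B * q ^ (9 * i) \<le> q ^ (3 + j) * ?M" using tgij(2) by (simp only:)
  have "card \<F> = card ({F \<in> \<F>. e \<notin> F} \<union> {F \<in> \<F>. e \<in> F})" by (rule arg_cong[of _ _ card]) blast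
  also have "\<dots> = A + B" unfolding A_def B_def by (rule card_Un_disjoint) auto
  finally have card_F: "card \<F> = A + B" .
  have "2 * (card \<F> choose 2) \<le> (A + B) ^ 2"
    unfolding card_F choose_two power2_eq_square
    by (rule order_trans[OF times_div_less_eq_dividend]) (intro mult_left_mono, auto)
  then have "A * (2 * (card \<F> choose 2)) \<le> A * (A + B) ^ 2" by (rule mult_left_mono) simp
  then have "2 * num_triangles \<F> \<le> A * (A + B) ^ 2"
    using num_triangles_le_avoiding[OF e(1), of \<F>] unfolding A_def by linarith
  then show ?thesis using triangle_bound_arith[OF q_ge_2 ij(3) A B] by linarith
qed

lemma ex_maximal_intersecting:
  assumes "\<F> \<subseteq> subspaces_of_dim k" "intersecting \<F>" "1 \<le> k"
  shows "\<exists>\<M>. \<F> \<subseteq> \<M> \<and> \<M> \<subseteq> subspaces_of_dim k \<and> intersecting \<M> \<and>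
    (\<forall>F\<in>subspaces_of_dim k. (\<forall>G\<in>\<M>. \<exists>v\<in>F \<inter> G. v \<noteq> 0) \<longrightarrow> F \<in> \<M>)"
proof -
  define \<A> where "\<A> = {\<G>. \<G> \<subseteq> subspaces_of_dim k \<and> intersecting \<G>}"
  have "finite \<A>" unfolding \<A>_def by (rule finite_triangles[OF finite_vectors])
  moreover have "\<F> \<in> \<A>" using assms by (simp add: \<A>_def)
  ultimately have "\<exists>\<M>\<in>\<A>. \<F> \<subseteq> \<M> \<and> (\<forall>\<G>\<in>\<A>. \<M> \<subseteq> \<G> \<longrightarrow> \<M> = \<G>)"
    by (rule finite_has_maximal2)
  then obtain \<M> where M: "\<M> \<in> \<A>" "\<F> \<subseteq> \<M>" "\<forall>\<G>\<in>\<A>. \<M> \<subseteq> \<G> \<longrightarrow> \<M> = \<G>"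
    by (elim bexE conjE)
  have "F \<in> \<M>" if F: "F \<in> subspaces_of_dim k" "\<And>G. G \<in> \<M> \<Longrightarrow> \<exists>v\<in>F \<inter> G. v \<noteq> 0" for F
  proof -
    have self: "\<exists>v\<in>F \<inter> F. v \<noteq> 0"
      using F(1) assms(3) one_le_dim_iff[of F] by (simp add: subspaces_of_dim_def)
    have "intersecting (insert F \<M>)"
      unfolding intersecting_iff
    proof (intro ballI)
      fix G H assume "G \<in> insert F \<M>" "H \<in> insert F \<M>"
      then consider "G = F" "H = F" | "G = F" "H \<in> \<M>" | "G \<in> \<M>" "H = F" | "G \<in> \<M>" "H \<in> \<M>" by blast
      then show "\<exists>v\<in>G \<inter> H. v \<noteq> 0"
      proof cases
        case 1 then show ?thesis using self by simp
      next
        case 2 then show ?thesis using F(2) by simp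
      next
        case 3 then show ?thesis using F(2)[of G] by (simp add: Int_commute)
      next
        case 4 then show ?thesis using M(1) unfolding \<A>_def intersecting_iff by blast
      qed
    qed
    then have "insert F \<M> \<in> \<A>" using F(1) M(1) by (simp add: \<A>_def)
    then show ?thesis using M(3) by (metis insertI1 subset_insertI)
  qed
  then show ?thesis using M(1,2) by (intro exI[of _ \<M>]) (simp add: \<A>_def)
qed

text \<open>
  Enlarging the family to a maximal one only adds triangles. If some vector were missed by no
  transversal line, the upper bound would stay below the number of triangles of a plane. So every
  nonzero vector is missed by one, and choosing \<open>L2\<close> to miss a vector of \<open>L1\<close> and then \<open>L3\<close> to miss the
  common point of these two gives three non-concurrent lines.
\<close>
lemma subset_subspace_family_or_few_triangles:
  assumes n: "2 * k + 9 \<le> dimension" "2 \<le> k"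
    and F: "\<F> \<subseteq> subspaces_of_dim k" "intersecting \<F>"
    and many: "n3 k \<le> num_triangles \<F>"
  shows "\<exists>X\<in>subspaces_of_dim 3. \<F> \<subseteq> subspace_family X k"
proof -
  let ?M = "num_containing k 2"
  have "0 < ?M" using n by (intro num_containing_pos) auto
  then have pos: "0 < q ^ 2 * ?M ^ 3" using q_ge_2 by simp
  obtain Y where Y: "subspace Y" "dim Y = 3"
    using ex_superset_of_dim[of "{}" 3] n by auto
  then have n3: "31 * (q ^ 2 * ?M ^ 3) \<le> 32 * n3 k"
    using num_triangles_subspace_family_ge_cube[OF n Y] n3_eq_num_triangles[OF finite_vectors Y]
    by (simp add: mult.assoc)
  have "1 \<le> k" using n by simp
  from ex_maximal_intersecting[OF F this]
  obtain \<M> where M: "\<F> \<subseteq> \<M>" "\<M> \<subseteq> subspaces_of_dim k" "intersecting \<M>"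
    and max': "\<forall>F\<in>subspaces_of_dim k. (\<forall>G\<in>\<M>. \<exists>v\<in>F \<inter> G. v \<noteq> 0) \<longrightarrow> F \<in> \<M>"
    by (elim exE conjE)
  have max: "F \<in> \<M>" if "F \<in> subspaces_of_dim k" "\<And>G. G \<in> \<M> \<Longrightarrow> \<exists>v\<in>F \<inter> G. v \<noteq> 0" for F
    using max' that by simp
  have many': "n3 k \<le> num_triangles \<M>" using many num_triangles_mono[OF M(1)] by linarith
  have nontriv: "\<exists>F\<in>\<M>. x \<notin> F" if "x \<noteq> 0" for x
  proof (rule ccontr)
    assume "\<not> (\<exists>F\<in>\<M>. x \<notin> F)"
    then have "{F \<in> \<M>. x \<notin> F} = {}" by blast
    then have "num_triangles \<M> = 0" using num_triangles_le_avoiding[OF that, of \<M>] by (simp only: card.empty)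
    then show False using many' n3 pos by linarith
  qed
  have line: "\<exists>L. transversal \<M> L \<and> x \<notin> L \<and> dim L = 2" if "x \<noteq> 0" for x
  proof (rule ccontr)
    assume no: "\<not> (\<exists>L. transversal \<M> L \<and> x \<notin> L \<and> dim L = 2)"
    have "3 \<le> dim W" if W: "transversal \<M> W" "x \<notin> W" for W
    proof -
      have "\<M> \<noteq> {}" using nontriv[OF \<open>x \<noteq> 0\<close>] by blast
      then have "2 \<le> dim W" by (intro transversal_dim_ge_2[OF W(1) nontriv _ M(2)])
      moreover have "dim W \<noteq> 2" using no W by blast
      ultimately show ?thesis by linarith
    qed
    from num_triangles_le_if_no_avoiding_line[OF n M(2,3) nontriv that this]
    have "64 * num_triangles \<M> \<le> 33 * (q ^ 2 * ?M ^ 3)" by (simp add: mult.assoc)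
    then show False using many' n3 pos by linarith
  qed
  have meet: "\<exists>v\<in>L \<inter> L'. v \<noteq> 0"
    if "transversal \<M> L" "transversal \<M> L'" "dim L = 2" "dim L' = 2" for L L'
    by (rule transversal_lines_meet[OF n max that])
  obtain y where "y \<in> Y" "y \<noteq> 0" using Y one_le_dim_iff[of Y] by auto
  then obtain L1 where L1: "transversal \<M> L1" "dim L1 = 2" using line by blast
  obtain w where w: "w \<in> L1" "w \<noteq> 0" using L1 one_le_dim_iff[of L1] by auto
  obtain L2 where L2: "transversal \<M> L2" "w \<notin> L2" "dim L2 = 2" using line[OF w(2)] by blast
  obtain e where e: "e \<in> L1 \<inter> L2" "e \<noteq> 0" using meet[OF L1(1) L2(1) L1(2) L2(3)] by blast
  obtain L3 where L3: "transversal \<M> L3" "e \<notin> L3" "dim L3 = 2" using line[OF e(2)] by blast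
  obtain u where u: "u \<in> L1 \<inter> L3" "u \<noteq> 0" using meet[OF L1(1) L3(1) L1(2) L3(3)] by blast
  obtain v where v: "v \<in> L2 \<inter> L3" "v \<noteq> 0" using meet[OF L2(1) L3(1) L2(3) L3(3)] by blast
  have "\<exists>X\<in>subspaces_of_dim 3. \<M> \<subseteq> subspace_family X k"
    by (rule subset_subspace_family_of_transversals[OF M(2) L1(1) L2(1) L3(1) L1(2) L2(3) L3(3)
          u v e L3(2) w(1) L2(2)])
  then show ?thesis using M(1) by blast
qed

text \<open>
  Each \<open>A\<close> in the star family cuts \<open>X\<close> in a line, which is the base of some triangle, so leaving \<open>A\<close> out
  loses a triangle.
\<close>
lemma star_subset_if_many_triangles:
  assumes n: "2 * k + 9 \<le> dimension" "2 \<le> k"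
    and X: "subspace X" "dim X = 3" and F: "\<F> \<subseteq> subspace_family X k"
    and many: "num_triangles (subspace_family X k) \<le> num_triangles \<F>"
  shows "subspace_family_star X k \<subseteq> \<F>"
proof (rule subsetI, rule ccontr)
  fix A assume A: "A \<in> subspace_family_star X k" "A \<notin> \<F>"
  then have A': "A \<in> subspaces_of_dim k" "subspace A" "dim (A \<inter> X) = 2"
    using X by (simp_all add: subspace_family_star_def subspaces_of_dim_def)
  obtain B where B: "B \<subseteq> A \<inter> X" "independent B" "A \<inter> X \<subseteq> span B" "card B = dim (A \<inter> X)"
    using basis_exists by blast
  then obtain x y where xy: "B = {x, y}" using A' by (auto simp: card_2_iff)
  have "\<not> X \<subseteq> A"
  proof
    assume "X \<subseteq> A"
    then have "A \<inter> X = X" by blast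
    then show False using A'(3) X(2) by simp
  qed
  then obtain z where z: "z \<in> X" "z \<notin> A" by blast
  have AX: "span {x, y} = A \<inter> X" using B A' X xy by (intro antisym span_minimal) (auto simp: subspace_inter)
  have "dim {x, y} = 2" using AX A'(3) by (metis dim_span)
  then have "dim (insert z {x, y}) = 3" using z AX by (simp add: dim_insert[of z])
  moreover have "insert z {x, y} = {x, y, z}" by blast
  ultimately have d: "dim {x, y, z} = 3" by simp
  have "{x, y, z} \<subseteq> X" using B xy z by blast
  then have spX: "span {x, y, z} \<subseteq> X" using X by (intro span_minimal)
  then have sp: "span {x, y, z} = X"
    using subspace_dim_equal[of "span {x, y, z}" X] X d by simp
  have "A \<in> base_side k z x y"
    using A' z B xy unfolding base_side_def by (auto intro!: exI[of _ 0])
  moreover have "card (pairs_meeting_in k z x y) \<noteq> 0"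
    using card_pairs_meeting_in_ge[OF n d] num_containing_pos[of 2 k] n by (intro notI) simp
  then have "pairs_meeting_in k z x y \<noteq> {}" by auto
  then obtain G H where "(G, H) \<in> pairs_meeting_in k z x y" by auto
  ultimately have T: "triangle {A, G, H}" "{A, G, H} \<subseteq> subspace_family X k"
    using base_side_triangle(1,2)[OF d] sp by simp_all
  have "{T. T \<subseteq> \<F> \<and> triangle T} \<subset> {T. T \<subseteq> subspace_family X k \<and> triangle T}"
  proof (rule psubsetI)
    show "{T. T \<subseteq> \<F> \<and> triangle T} \<subseteq> {T. T \<subseteq> subspace_family X k \<and> triangle T}" using F by blast
    show "{T. T \<subseteq> \<F> \<and> triangle T} \<noteq> {T. T \<subseteq> subspace_family X k \<and> triangle T}"
    proof
      assume eq: "{T. T \<subseteq> \<F> \<and> triangle T} = {T. T \<subseteq> subspace_family X k \<and> triangle T}"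
      have "{A, G, H} \<in> {T. T \<subseteq> \<F> \<and> triangle T}" unfolding eq using T by simp
      then show False using A(2) by simp
    qed
  qed
  then have "num_triangles \<F> < num_triangles (subspace_family X k)"
    unfolding num_triangles_def by (rule psubset_card_mono[OF finite_triangles[OF finite_vectors]])
  then show False using many by simp
qed

end

theorem corollary1p2:
  fixes scale :: "'f::{field,finite} \<Rightarrow> 'v::ab_group_add \<Rightarrow> 'v"
    and q n k :: nat
    and \<F> :: "'v set set"
  assumes "vector_space scale"
    and "primepow q"
    and "card (UNIV :: 'f set) = q"
    and "vector_space.dim scale (UNIV :: 'v set) = n"
    and "k \<ge> 2"
    and "n \<ge> 2 * k + 9"
    and "\<F> \<subseteq> vector_space.subspaces_of_dim scale k"
    and "vector_space.intersecting scale \<F>"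
  shows "vector_space.num_triangles scale \<F> \<le> vector_space.n3 scale k \<and>
    (vector_space.num_triangles scale \<F> = vector_space.n3 scale k \<longleftrightarrow>
      (\<exists>X \<in> vector_space.subspaces_of_dim scale 3.
        vector_space.subspace_family_star scale X k \<subseteq> \<F> \<and>
        \<F> \<subseteq> vector_space.subspace_family scale X k))"
proof -
  interpret vector_space scale by fact
  obtain B where B: "independent B" "UNIV \<subseteq> span B" "card B = dim (UNIV :: 'v set)"
    using basis_exists[of UNIV] by metis
  then have "finite B" using assms(4-6) by (intro card_ge_0_finite) simp
  then interpret vector_space_over_finite_field scale B q
    using B assms(3) by unfold_locales auto
  have n: "2 * k + 9 \<le> dimension" using assms(4,6) by (simp add: dimension_def)
  have sub3: "subspace X" "dim X = 3" if "X \<in> subspaces_of_dim 3" for X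
    using that by (simp_all add: subspaces_of_dim_def)
  have n3: "n3 k = num_triangles (subspace_family X k)" if "X \<in> subspaces_of_dim 3" for X
    by (rule n3_eq_num_triangles[OF finite_vectors sub3[OF that]])
  show ?thesis
  proof (cases "\<exists>X\<in>subspaces_of_dim 3. \<F> \<subseteq> subspace_family X k")
    case False
    then have "num_triangles \<F> < n3 k"
      using subset_subspace_family_or_few_triangles[OF n assms(5,7,8)] by (meson not_le)
    then show ?thesis using False by auto
  next
    case True
    then obtain X where X: "X \<in> subspaces_of_dim 3" "\<F> \<subseteq> subspace_family X k" by blast
    have le: "num_triangles \<F> \<le> n3 k" using num_triangles_mono[OF X(2)] n3[OF X(1)] by simp
    have "subspace_family_star X k \<subseteq> \<F>" if "num_triangles \<F> = n3 k"
      using star_subset_if_many_triangles[OF n assms(5) sub3[OF X(1)] X(2)] n3[OF X(1)] that by simp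
    moreover have "num_triangles \<F> = n3 k"
      if "Y \<in> subspaces_of_dim 3" "subspace_family_star Y k \<subseteq> \<F>" "\<F> \<subseteq> subspace_family Y k" for Y
      using num_triangles_between[OF sub3[OF that(1)] that(2,3)] n3[OF that(1)] by simp
    ultimately show ?thesis using le X by blast
  qed
qed

end
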